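(* Let $L$ be a modular lattice. Then the following assertions hold: (i) If every element of $\operatorname{Dim}L$ has finite index, then $L$ is locally finitely distributive. (ii) If $L$ is relatively complemented and locally finitely distributive, then every element of $\operatorname{Dim}L$ has finite index.
   Context: Lattices are not assumed to be bounded. For a lattice $L$, the dimension monoid $\operatorname{Dim}L$ is the commutative monoid defined by generators $\Delta(a,b)$ (for $a\leq b$ in $L$) and the relations: (D0) $\Delta(a,a)=0$; (D1) $\Delta(a,c)=\Delta(a,b)+\Delta(b,c)$ for $a\leq b\leq c$; (D2) $\Delta(a,a\vee b)=\Delta(a\wedge b,b)$ for all $a,b\in L$. It is always conical ($x+y=0$ implies $x=y=0$). Let $M$ be a conical commutative monoid with its algebraic preordering ($x\leq y$ iff $x+z=y$ for some $z$). The index of $x\in M$ is the largest $n\in\{0,1,2,\ldots\}$ such that there is $y\in M\setminus\{0\}$ with $ny\leq x$, if such a largest $n$ exists, and $\infty$ otherwise (with the index of the elements of the trivial monoid being $0$). For a positive integer $n$, a modular lattice is $n$-distributive if it satisfies the identity $$x\vee\bigwedge_{i\leq n}y_i=\bigwedge_{i\leq n}\Bigl(x\vee\bigwedge_{j\leq n;\ j\neq i}y_j\Bigr)$$ (indices $i,j$ range over $\{0,1,\ldots,n\}$). It is finitely distributive if it is $n$-distributive for some positive integer $n$, and locally finitely distributive if every closed interval of it is finitely distributive. A lattice is relatively complemented if every closed interval $[a,b]$ of it is complemented. *)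

theory Defs
  imports "HOL-Library.Multiset" "HOL-Library.Extended_Nat" "HOL-Library.Interval"
begin

unbundle lattice_syntax

section \<open>Lattices\<close>

class modular_lattice = lattice +
  assumes modular_law: "x \<le> z \<Longrightarrow> x \<squnion> (y \<sqinter> z) = (x \<squnion> y) \<sqinter> z"

text \<open>The predicates below are relative to a sublattice \<open>S\<close> of the ambient lattice, so that
  they apply both to the whole lattice (\<open>S = UNIV\<close>) and to its closed intervals.  For
  \<open>n \<ge> 1\<close> all the finite meets are over nonempty sets, so no bounds are needed.\<close>

definition n_distributive_on :: "nat \<Rightarrow> 'a::modular_lattice set \<Rightarrow> bool" where
  "n_distributive_on n S \<longleftrightarrow>
     (\<forall>x\<in>S. \<forall>y :: nat \<Rightarrow> 'a. (\<forall>i\<le>n. y i \<in> S) \<longrightarrow>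
        x \<squnion> (\<Sqinter>\<^sub>f\<^sub>i\<^sub>n (y ` {i. i \<le> n})) =
        \<Sqinter>\<^sub>f\<^sub>i\<^sub>n ((\<lambda>i. x \<squnion> \<Sqinter>\<^sub>f\<^sub>i\<^sub>n (y ` {j. j \<le> n \<and> j \<noteq> i})) ` {i. i \<le> n}))"

definition finitely_distributive_on :: "'a::modular_lattice set \<Rightarrow> bool" where
  "finitely_distributive_on S \<longleftrightarrow> (\<exists>n\<ge>1. n_distributive_on n S)"

definition locally_finitely_distributive_on :: "'a::modular_lattice set \<Rightarrow> bool" where
  "locally_finitely_distributive_on S \<longleftrightarrow>
     (\<forall>a\<in>S. \<forall>b\<in>S. a \<le> b \<longrightarrow> finitely_distributive_on (S \<inter> {a..b}))"

definition relatively_complemented_on :: "'a::lattice set \<Rightarrow> bool" where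
  "relatively_complemented_on S \<longleftrightarrow>
     (\<forall>a\<in>S. \<forall>b\<in>S. a \<le> b \<longrightarrow>
        (\<forall>x \<in> S \<inter> {a..b}. \<exists>y \<in> S \<inter> {a..b}. x \<sqinter> y = a \<and> x \<squnion> y = b))"


section \<open>The dimension monoid\<close>

text \<open>Elements of \<^typ>\<open>'a interval\<close> are the pairs \<open>(a, b)\<close> with \<open>a \<le> b\<close>, and finite multisets
  form the free commutative monoid; \<open>dim_cong\<close> is the monoid congruence generated by the
  defining relations.  The side conditions ensure that \<^const>\<open>Interval\<close> is applied only to
  pairs in its proper domain.\<close>

inductive dim_cong :: "'a::lattice interval multiset \<Rightarrow> 'a interval multiset \<Rightarrow> bool" where
  D0: "dim_cong {#Interval (a, a)#} {#}"
| D1: "a \<le> b \<Longrightarrow> b \<le> c \<Longrightarrow>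
         dim_cong {#Interval (a, c)#} {#Interval (a, b), Interval (b, c)#}"
| D2: "dim_cong {#Interval (a, a \<squnion> b)#} {#Interval (a \<sqinter> b, b)#}"
| refl: "dim_cong X X"
| sym: "dim_cong X Y \<Longrightarrow> dim_cong Y X"
| trans: "dim_cong X Y \<Longrightarrow> dim_cong Y Z \<Longrightarrow> dim_cong X Z"
| add: "dim_cong X Y \<Longrightarrow> dim_cong X' Y' \<Longrightarrow> dim_cong (X + X') (Y + Y')"

quotient_type (overloaded) 'a dim = "'a::lattice interval multiset" / dim_cong
  morphisms rep_dim abs_dim
  by (intro equivpI reflpI sympI transpI) (blast intro: dim_cong.intros)+

instantiation dim :: (lattice) comm_monoid_add
begin

lift_definition zero_dim :: "'a dim" is "{#}" .

lift_definition plus_dim :: "'a dim \<Rightarrow> 'a dim \<Rightarrow> 'a dim" is "(+)"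
  by (rule dim_cong.add)

instance
  by standard (transfer, simp add: ac_simps dim_cong.refl)+

end

definition Delta :: "'a::lattice \<Rightarrow> 'a \<Rightarrow> 'a dim" where
  "Delta a b = abs_dim {#Interval (a, b)#}"

lemma Delta_D0: "Delta a a = 0"
  by (simp add: Delta_def zero_dim_def dim.abs_eq_iff dim_cong.D0)

lemma Delta_D1: "a \<le> b \<Longrightarrow> b \<le> c \<Longrightarrow> Delta a c = Delta a b + Delta b c"
  using dim_cong.D1[of a b c]
  by (simp add: Delta_def plus_dim.abs_eq dim.abs_eq_iff add_mset_commute)

lemma Delta_D2: "Delta a (a \<squnion> b) = Delta (a \<sqinter> b) b"
  by (simp add: Delta_def dim.abs_eq_iff dim_cong.D2)

lemma lower_Interval: "a \<le> b \<Longrightarrow> lower (Interval (a, b)) = a"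
  and upper_Interval: "a \<le> b \<Longrightarrow> upper (Interval (a, b)) = b"
  by (simp_all add: lower.rep_eq upper.rep_eq Interval_inverse)

lemma dim_cong_degenerate:
  assumes "dim_cong X Y"
  shows "(\<forall>I\<in>#X. lower I = upper I) \<longleftrightarrow> (\<forall>I\<in>#Y. lower I = upper I)"
  using assms
proof induction
  case (D1 a b c)
  then show ?case
    by (auto simp: lower_Interval upper_Interval intro: order.antisym)
next
  case (D2 a b)
  then show ?case
    by (simp add: lower_Interval upper_Interval)
       (metis inf.absorb_iff2 inf_commute le_iff_sup sup_commute)
qed (auto simp: lower_Interval upper_Interval)

lemma dim_cong_empty:
  assumes "\<forall>I\<in>#X. lower I = upper I"
  shows "dim_cong X {#}"
  using assms
proof (induction X)
  case empty
  show ?case by (rule dim_cong.refl)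
next
  case (add I X)
  have "I = Interval (lower I, lower I)"
    using add.prems by (intro interval_eqI) (simp_all add: lower_Interval upper_Interval)
  then have "dim_cong {#I#} {#}"
    by (metis dim_cong.D0)
  with add show ?case
    using dim_cong.add[of "{#I#}" "{#}" X "{#}"] by simp
qed

lemma dim_conical:
  fixes x y :: "'a::lattice dim"
  assumes "x + y = 0"
  shows "x = 0 \<and> y = 0"
  using assms
proof transfer
  fix X Y :: "'a interval multiset"
  assume "dim_cong (X + Y) {#}"
  from dim_cong_degenerate[OF this]
  show "dim_cong X {#} \<and> dim_cong Y {#}"
    by (auto intro: dim_cong_empty)
qed


section \<open>The index of an element of a conical commutative monoid\<close>

definition alg_le :: "'m::comm_monoid_add \<Rightarrow> 'm \<Rightarrow> bool" where
  "alg_le x y \<longleftrightarrow> (\<exists>z. x + z = y)"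

definition index_bound :: "'m::comm_monoid_add \<Rightarrow> nat \<Rightarrow> bool" where
  "index_bound x n \<longleftrightarrow> (\<exists>y. y \<noteq> 0 \<and> alg_le (\<Sum>_<n. y) x)"

text \<open>In the trivial monoid no \<open>n\<close> satisfies \<^term>\<open>index_bound x n\<close>, hence the first case.\<close>

definition index :: "'m::comm_monoid_add \<Rightarrow> enat" where
  "index x =
     (if \<forall>y::'m. y = 0 then 0
      else if \<exists>n. index_bound x n \<and> (\<forall>m. index_bound x m \<longrightarrow> m \<le> n)
      then enat (GREATEST n. index_bound x n)
      else \<infinity>)"

end

theory Submission
  imports Defs
begin

text \<open>
  Both assertions compare \<open>n\<close>-distributivity of \<open>[a, b]\<close> with the number of independent copies of
  one nontrivial interval that fit into \<open>[a, b]\<close>.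

  From index to distributivity.  Suppose that \<open>x\<close> and \<open>y\<^sub>0, \<dots>, y\<^sub>n\<close> in \<open>[a, b]\<close> violate the
  \<open>n\<close>-distributive law.  Let \<open>z\<^sub>i\<close> be the meet of the \<open>y\<^sub>j\<close> with \<open>j \<noteq> i\<close>, and \<open>p\<close> the meet of all \<open>y\<^sub>j\<close>.
  The \<open>z\<^sub>i\<close> are independent over \<open>p\<close>, and the nontrivial interval between the two sides of the law
  is a transpose of a subinterval of every \<open>[p, z\<^sub>i]\<close>.  So its dimension, taken \<open>n + 1\<close> times, lies below \<open>\<Delta>(a, b)\<close>
  (\<open>index_bound_if_not_n_distributive\<close>), and a bound for the index bounds \<open>n\<close>.

  From distributivity to index.  Equality in the dimension monoid of a modular lattice means that
  two multisets of intervals can be cut into pieces that agree up to transposition.  This is the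
  Schreier refinement theorem, presented here as confluence of a reduction relation that cuts and
  transposes intervals (\<open>dissects_confluent\<close>, \<open>dim_cong_imp_common_dissection\<close>).  Hence, if
  \<open>n y \<le> x\<close> with \<open>y \<noteq> 0\<close>, the intervals that make up \<open>x\<close> can be cut so that one nondegenerate
  interval \<open>I\<close> occurs at least \<open>n\<close> times among the pieces: take a nondegenerate interval of \<open>y\<close>,
  and a common dissection of its \<open>n\<close> copies.  It remains to bound the multiplicity of \<open>I\<close> in a
  dissection of one \<open>n\<close>-distributive interval \<open>[a, b]\<close>.

  Relative complements turn the steps of a chain from \<open>a\<close> to \<open>b\<close> into an independent family over
  \<open>a\<close>, whose members are all projective to \<open>I\<close> and therefore to each other
  (\<open>dissects_imp_packed\<close>).  The projectivities may leave \<open>[a, b]\<close>, but in a relatively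
  complemented modular lattice two projective independent intervals contain nontrivial
  perspective parts (\<open>projective_imp_perspective_parts\<close>).  Passing to such parts repeatedly yields
  an independent family of nontrivial elements that are all perspective to the first one.  When it
  has \<open>n + 1\<close> members, the join \<open>x\<close> of the axes and the joins \<open>y\<^sub>i\<close> of all members but the
  \<open>i\<close>-th violate the \<open>n\<close>-distributive law (\<open>homogeneous_family_not_n_distributive\<close>).
\<close>

section \<open>Perspectivity over a fixed bottom element\<close>

lemma inf_eq_mono:
  fixes s :: "'a::lattice"
  assumes "x \<sqinter> y = s" "s \<le> x'" "x' \<le> x" "s \<le> y'" "y' \<le> y"
  shows "x' \<sqinter> y' = s"
proof (rule order.antisym)
  show "x' \<sqinter> y' \<le> s" using inf_mono[OF assms(3,5)] assms(1) by simp
qed (use assms in simp)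

lemma inf_drop:
  fixes t :: "'a::lattice"
  assumes "x \<le> t"
  shows "x \<sqinter> (y \<sqinter> t) = x \<sqinter> y"
  using assms by (intro order.antisym) (auto intro: le_infI1 le_infI2)

lemma inf_cut:
  fixes t :: "'a::lattice"
  assumes "x \<le> t" "y \<sqinter> t = z"
  shows "x \<sqinter> y = x \<sqinter> z"
  using inf_drop[OF assms(1), of y] assms(2) by simp

lemma inf_eq_ge: "x \<sqinter> y = s \<Longrightarrow> s \<le> x" "x \<sqinter> y = s \<Longrightarrow> s \<le> (y::'a::lattice)"
  by auto

text \<open>
  Perspectivity of \<open>[s, x]\<close> and \<open>[s, y]\<close>: both transpose up to one interval, whose lower end \<open>c\<close> is
  called the axis.
\<close>

definition perspective :: "'a::modular_lattice \<Rightarrow> 'a \<Rightarrow> 'a \<Rightarrow> bool" where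
  "perspective s x y \<longleftrightarrow> (\<exists>c. x \<sqinter> c = s \<and> y \<sqinter> c = s \<and> x \<squnion> c = y \<squnion> c)"

lemma perspectiveI:
  "x \<sqinter> c = s \<Longrightarrow> y \<sqinter> c = s \<Longrightarrow> x \<squnion> c = y \<squnion> c \<Longrightarrow> perspective s x y"
  unfolding perspective_def by blast

lemma perspective_sym: "perspective s x y \<Longrightarrow> perspective s y x"
  unfolding perspective_def by metis

lemma perspective_ge: "perspective s x y \<Longrightarrow> s \<le> x \<and> s \<le> y"
  unfolding perspective_def using inf_eq_ge by blast

lemma perspective_refl: "s \<le> x \<Longrightarrow> perspective s x x"
  unfolding perspective_def by (metis inf.absorb2)

lemma perspective_bottom_iff: 
  assumes "perspective s x y" shows "x = s \<longleftrightarrow> y = s"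
proof -
  obtain c where "x \<sqinter> c = s" "y \<sqinter> c = s" "x \<squnion> c = y \<squnion> c"
    using assms unfolding perspective_def by blast
  then show ?thesis by (metis inf.absorb1 inf_sup_absorb inf_commute sup_commute le_iff_sup inf_le2)
qed

text \<open>
  Cutting any axis down to \<open>x \<squnion> y\<close> gives another axis.
\<close>

lemma perspective_axis_below_join:
  assumes "perspective s x y"
  obtains c where "c \<le> x \<squnion> y" "x \<sqinter> c = s" "y \<sqinter> c = s" "x \<squnion> c = x \<squnion> y" "y \<squnion> c = x \<squnion> y"
proof -
  obtain c where c: "x \<sqinter> c = s" "y \<sqinter> c = s" "x \<squnion> c = y \<squnion> c"
    using assms unfolding perspective_def by blast
  have le: "x \<squnion> y \<le> x \<squnion> c" using c(3) by (metis le_sup_iff sup_ge1)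
  have "x \<squnion> (c \<sqinter> (x \<squnion> y)) = x \<squnion> y" "y \<squnion> (c \<sqinter> (x \<squnion> y)) = x \<squnion> y"
    using le c(3) by (simp_all add: modular_law inf.absorb2)
  moreover have "x \<sqinter> (c \<sqinter> (x \<squnion> y)) = s" "y \<sqinter> (c \<sqinter> (x \<squnion> y)) = s"
    using c by (simp_all add: inf_drop)
  ultimately show thesis by (intro that[of "c \<sqinter> (x \<squnion> y)"]) simp_all
qed

text \<open>
  A perspectivity is an isomorphism of intervals, so it carries a part of \<open>x\<close> to a part of \<open>y\<close>; the
  axis can be kept.
\<close>

lemma perspective_restrict:
  assumes "perspective s x y" "s \<le> x'" "x' \<le> x"
  obtains y' where "y' \<le> y" "perspective s x' y'"
proof -
  obtain c where c: "x \<sqinter> c = s" "y \<sqinter> c = s" "x \<squnion> c = y \<squnion> c"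
    using assms(1) unfolding perspective_def by blast
  let ?y = "(x' \<squnion> c) \<sqinter> y"
  have "s \<le> c" "s \<le> y" using c(2) by (auto dest: inf_eq_ge)
  have 1: "x' \<sqinter> c = s"
    using inf_eq_mono[OF c(1) assms(2,3) \<open>s \<le> c\<close>] by simp
  have 2: "?y \<sqinter> c = s"
    by (rule inf_eq_mono[OF c(2)]) (use \<open>s \<le> c\<close> \<open>s \<le> y\<close> in \<open>simp_all add: le_supI2\<close>)
  have "x' \<squnion> c \<le> c \<squnion> y"
    using assms(3) c(3) by (metis sup_commute sup_mono order.refl)
  then have 3: "?y \<squnion> c = x' \<squnion> c"
    using modular_law[of c "x' \<squnion> c" y] by (simp add: inf_commute sup_commute inf.absorb2 inf.absorb1)
  show thesis using that[of ?y] perspectiveI[OF 1 2] 3 by simp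
qed

text \<open>
  Independence of a triple is symmetric, although stated by two asymmetric equations.
\<close>

lemma independent_rotate:
  assumes "x \<sqinter> (y \<squnion> z) = s" "y \<sqinter> z = (s::'a::modular_lattice)"
  shows "z \<sqinter> (x \<squnion> y) = s"
proof -
  have "s \<le> y" using inf_eq_ge(1)[OF assms(2)] .
  have "(x \<squnion> y) \<sqinter> (y \<squnion> z) = y \<squnion> (x \<sqinter> (y \<squnion> z))"
    using modular_law[of y "y \<squnion> z" x] by (simp add: sup_commute)
  also have "\<dots> = y" using assms(1) \<open>s \<le> y\<close> by (simp add: sup.absorb1)
  finally have "z \<sqinter> (x \<squnion> y) = z \<sqinter> y" by (rule inf_cut[rotated]) simp
  then show ?thesis using assms(2) by (simp add: inf_commute)
qed

text \<open>
  For an independent triple, perspectivity is transitive: if \<open>c\<close> and \<open>d\<close> are axes for \<open>x, y\<close> and for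
  \<open>y, z\<close> that lie below the respective joins, then \<open>(c \<squnion> d) \<sqinter> (x \<squnion> z)\<close> is one for \<open>x, z\<close>.
\<close>

lemma perspective_trans_independent:
  assumes "perspective s x y" "perspective s y z" "x \<sqinter> (y \<squnion> z) = s" "z \<sqinter> (x \<squnion> y) = s"
  shows "perspective s x z"
proof -
  obtain c where c: "c \<le> x \<squnion> y" "x \<sqinter> c = s" "y \<sqinter> c = s" "x \<squnion> c = x \<squnion> y" "y \<squnion> c = x \<squnion> y"
    using perspective_axis_below_join[OF assms(1)] by metis
  obtain d where d: "d \<le> y \<squnion> z" "y \<sqinter> d = s" "z \<sqinter> d = s" "y \<squnion> d = y \<squnion> z" "z \<squnion> d = y \<squnion> z"
    using perspective_axis_below_join[OF assms(2)] by metis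
  have meet: "p \<sqinter> (e \<squnion> f) = s"
    if "e \<le> p \<squnion> q" "p \<sqinter> e = s" "f \<le> q \<squnion> r" "q \<sqinter> f = s" "r \<sqinter> (p \<squnion> q) = s" "s \<le> q" for p q r e f
  proof -
    have "(p \<squnion> q) \<sqinter> (q \<squnion> r) = q"
      using modular_law[of q "p \<squnion> q" r] that(5,6) by (simp add: sup.absorb1 inf_commute)
    then have "f \<sqinter> (p \<squnion> q) = f \<sqinter> q" by (rule inf_cut[OF that(3)])
    then have "f \<sqinter> (p \<squnion> q) = s" using that(4) by (simp add: inf_commute)
    moreover have "s \<le> e" using inf_eq_ge(2)[OF that(2)] .
    ultimately have "(e \<squnion> f) \<sqinter> (p \<squnion> q) = e"
      using modular_law[OF that(1), of f] by (simp add: sup.absorb1)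
    then have "p \<sqinter> (e \<squnion> f) = p \<sqinter> e" by (rule inf_cut[rotated]) simp
    then show ?thesis using that by simp
  qed
  have s: "s \<le> y" using inf_eq_ge(1)[OF c(3)] .
  have m: "x \<sqinter> (c \<squnion> d) = s" "z \<sqinter> (c \<squnion> d) = s"
    using meet[OF c(1,2) d(1,2) assms(4) s] meet[of d z y c x] c d assms(3) s
    by (simp_all add: sup_commute)
  let ?e = "(c \<squnion> d) \<sqinter> (x \<squnion> z)"
  have j: "x \<squnion> (c \<squnion> d) = x \<squnion> y \<squnion> z" "z \<squnion> (c \<squnion> d) = x \<squnion> y \<squnion> z"
    using c d by (metis sup.assoc sup.commute)+
  have "x \<squnion> ?e = x \<squnion> z" "z \<squnion> ?e = x \<squnion> z"
    using j by (simp_all add: modular_law inf.absorb2 le_supI1)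
  moreover have "x \<sqinter> ?e = s" "z \<sqinter> ?e = s"
    using m by (simp_all add: inf_drop)
  ultimately show ?thesis by (intro perspectiveI[of _ ?e]) simp_all
qed

text \<open>
  The requirement \<open>x' \<noteq> s\<close> makes both parts nontrivial, by \<open>perspective_bottom_iff\<close>.
\<close>

definition perspective_parts :: "'a::modular_lattice \<Rightarrow> 'a \<Rightarrow> 'a \<Rightarrow> bool" where
  "perspective_parts s x z \<longleftrightarrow> (\<exists>x'\<le>x. \<exists>z'\<le>z. x' \<noteq> s \<and> perspective s x' z')"

lemma perspective_parts_sym: "perspective_parts s x z \<Longrightarrow> perspective_parts s z x"
  unfolding perspective_parts_def using perspective_bottom_iff perspective_sym by metis

lemma perspective_parts_mono:
  "perspective_parts s x z \<Longrightarrow> x \<le> u \<Longrightarrow> z \<le> v \<Longrightarrow> perspective_parts s u v"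
  unfolding perspective_parts_def using order.trans by metis

lemma relative_complement:
  fixes a b x :: "'a::lattice"
  assumes "relatively_complemented_on (UNIV :: 'a set)" "a \<le> x" "x \<le> b"
  obtains y where "x \<sqinter> y = a" "x \<squnion> y = b"
  using assms unfolding relatively_complemented_on_def by (metis IntI UNIV_I atLeastAtMost_iff order.trans)

lemma nontrivial_part_outside:
  fixes x w s :: "'a::modular_lattice"
  assumes "relatively_complemented_on (UNIV :: 'a set)" "s \<le> x" "s \<le> w" "\<not> x \<le> w"
  obtains x' where "s \<le> x'" "x' \<le> x" "x' \<noteq> s" "x' \<sqinter> w = s"
proof -
  obtain y where y: "(x \<sqinter> w) \<sqinter> y = s" "(x \<sqinter> w) \<squnion> y = x"
    using relative_complement[OF assms(1), of s "x \<sqinter> w" x] assms by auto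
  have "y \<le> x" using y(2) by (metis sup_ge2)
  show thesis
  proof (rule that[of y])
    show "s \<le> y" using y(1) by (metis inf_le2)
    show "y \<noteq> s" using y assms by (metis inf_le2 le_inf_iff sup.absorb1)
    show "y \<sqinter> w = s" using y(1) inf_drop[OF \<open>y \<le> x\<close>, of w] by (simp add: ac_simps)
  qed (fact \<open>y \<le> x\<close>)
qed

text \<open>
  A part \<open>x'\<close> of \<open>x\<close> that is disjoint from \<open>y \<squnion> z\<close> forms, with its images in \<open>y\<close> and \<open>z\<close>, an
  independent triple.
\<close>

lemma perspective_parts_trans_outside:
  fixes x y z s :: "'a::modular_lattice"
  assumes rc: "relatively_complemented_on (UNIV :: 'a set)"
    and "perspective s x y" "perspective s y z" "y \<sqinter> z = s" "\<not> x \<le> y \<squnion> z"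
  shows "perspective_parts s x z"
proof -
  have ge: "s \<le> x" "s \<le> y" "s \<le> z" using assms perspective_ge by blast+
  obtain x' where x': "s \<le> x'" "x' \<le> x" "x' \<noteq> s" "x' \<sqinter> (y \<squnion> z) = s"
    using nontrivial_part_outside[OF rc _ _ assms(5)] ge by (metis le_supI1)
  obtain y' where y': "y' \<le> y" "perspective s x' y'"
    using perspective_restrict[OF assms(2) x'(1,2)] by blast
  obtain z' where z': "z' \<le> z" "perspective s y' z'"
    using perspective_restrict[OF assms(3) _ y'(1)] y'(2) perspective_ge by blast
  have ge': "s \<le> y'" "s \<le> z'" using y' z' perspective_ge by blast+
  have 1: "y' \<sqinter> z' = s" by (rule inf_eq_mono[OF assms(4) ge'(1) y'(1) ge'(2) z'(1)])
  have 2: "x' \<sqinter> (y' \<squnion> z') = s"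
    by (rule inf_eq_mono[OF x'(4,1) order.refl])
      (use y'(1) z'(1) ge' in \<open>simp_all add: le_supI1 le_supI2\<close>)
  have "perspective s x' z'"
    using perspective_trans_independent[OF y'(2) z'(2) 2 independent_rotate[OF 2 1]] .
  then show ?thesis using x' z' unfolding perspective_parts_def by blast
qed

text \<open>
  Perspectivity itself is not transitive, but it is up to passing to nontrivial parts.  Whenever two
  of \<open>x, y, z\<close> overlap, the overlap and its image do.  Otherwise, if one of the three is not below
  the join of the other two, a part of it belongs to an independent triple.  In the remaining case
  the three pairwise joins coincide, and \<open>y\<close> itself is an axis for \<open>x\<close> and \<open>z\<close>.
\<close>

lemma perspective_parts_trans:
  fixes x y z s :: "'a::modular_lattice"
  assumes rc: "relatively_complemented_on (UNIV :: 'a set)"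
    and xy: "perspective s x y" and yz: "perspective s y z" and "x \<noteq> s"
  shows "perspective_parts s x z"
proof -
  have ge: "s \<le> x" "s \<le> y" "s \<le> z" using xy yz perspective_ge by blast+
  consider "x \<sqinter> z \<noteq> s" | "x \<sqinter> y \<noteq> s" | "y \<sqinter> z \<noteq> s"
    | "x \<sqinter> z = s" "x \<sqinter> y = s" "y \<sqinter> z = s" by blast
  then show ?thesis
  proof cases
    case 1
    have "perspective s (x \<sqinter> z) (x \<sqinter> z)" using ge by (simp add: perspective_refl)
    then show ?thesis using 1 unfolding perspective_parts_def by (metis inf_le1 inf_le2)
  next
    case 2
    obtain z' where "z' \<le> z" "perspective s (x \<sqinter> y) z'"
      using perspective_restrict[OF yz, of "x \<sqinter> y"] ge by auto
    then show ?thesis using 2 unfolding perspective_parts_def by (metis inf_le1)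
  next
    case 3
    obtain x' where x': "x' \<le> x" "perspective s (y \<sqinter> z) x'"
      using perspective_restrict[OF perspective_sym[OF xy], of "y \<sqinter> z"] ge by auto
    then have "perspective_parts s z x" using 3 unfolding perspective_parts_def by (metis inf_le2)
    then show ?thesis by (rule perspective_parts_sym)
  next
    case 4
    consider "\<not> x \<le> y \<squnion> z" | "\<not> z \<le> y \<squnion> x" | "\<not> y \<le> x \<squnion> z"
      | "x \<le> y \<squnion> z" "z \<le> y \<squnion> x" "y \<le> x \<squnion> z" by blast
    then show ?thesis
    proof cases
      case 1
      show ?thesis using perspective_parts_trans_outside[OF rc xy yz 4(3) 1] .
    next
      case 2
      show ?thesis
        using perspective_parts_trans_outside[OF rc yz[THEN perspective_sym] xy[THEN perspective_sym] _ 2]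
          4 perspective_parts_sym by (metis inf_commute)
    next
      case 3
      obtain y' where y': "s \<le> y'" "y' \<le> y" "y' \<noteq> s" "y' \<sqinter> (x \<squnion> z) = s"
        using nontrivial_part_outside[OF rc _ _ 3] ge by (metis le_supI1)
      obtain x' where x': "x' \<le> x" "perspective s y' x'"
        using perspective_restrict[OF perspective_sym[OF xy] y'(1,2)] by blast
      obtain z' where z': "z' \<le> z" "perspective s y' z'"
        using perspective_restrict[OF yz y'(1,2)] by blast
      have ge': "s \<le> x'" "s \<le> z'" using x' z' perspective_ge by blast+
      have a: "x' \<sqinter> z' = s" by (rule inf_eq_mono[OF 4(1) ge'(1) x'(1) ge'(2) z'(1)])
      have b: "y' \<sqinter> (x' \<squnion> z') = s"
        by (rule inf_eq_mono[OF y'(4,1) order.refl])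
          (use x'(1) z'(1) ge' in \<open>simp_all add: le_supI1 le_supI2\<close>)
      have "perspective s x' z'"
      proof (rule perspective_trans_independent[OF perspective_sym[OF x'(2)] z'(2)])
        show "x' \<sqinter> (y' \<squnion> z') = s"
          using independent_rotate[of y' z' x'] a b by (simp add: inf_commute sup_commute)
        show "z' \<sqinter> (x' \<squnion> y') = s"
          using independent_rotate[of y' x' z'] a b by (simp add: sup_commute)
      qed
      moreover have "x' \<noteq> s" using x'(2) y'(3) perspective_bottom_iff by blast
      ultimately show ?thesis using x' z' unfolding perspective_parts_def by blast
    next
      case d: 4
      then have "x \<squnion> y = z \<squnion> y"
        by (intro order.antisym) (simp_all add: sup_commute)
      then have "perspective s x z"
        using 4 by (intro perspectiveI[of x y]) (simp_all add: inf_commute)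
      then show ?thesis using \<open>x \<noteq> s\<close> unfolding perspective_parts_def by blast
    qed
  qed
qed

text \<open>
  Joining with an element \<open>a\<close> that is disjoint from \<open>x \<squnion> y\<close> is an isomorphism from \<open>[s, x \<squnion> y]\<close> onto
  \<open>[a, a \<squnion> x \<squnion> y]\<close>.
\<close>

lemma perspective_shift:
  assumes "perspective s x y" "a \<sqinter> (x \<squnion> y) = s"
  shows "perspective a (a \<squnion> x) (a \<squnion> y)"
proof -
  obtain c where c: "c \<le> x \<squnion> y" "x \<sqinter> c = s" "y \<sqinter> c = s" "x \<squnion> c = x \<squnion> y" "y \<squnion> c = x \<squnion> y"
    using perspective_axis_below_join[OF assms(1)] by metis
  have "s \<le> c" using inf_eq_ge(2)[OF c(2)] .
  have "(a \<squnion> c) \<sqinter> (x \<squnion> y) = c"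
    using modular_law[OF c(1), of a] assms(2) \<open>s \<le> c\<close> by (simp add: sup_commute sup.absorb1 sup.absorb2)
  then have m: "x \<sqinter> (a \<squnion> c) = x \<sqinter> c" "y \<sqinter> (a \<squnion> c) = y \<sqinter> c"
    by (rule inf_cut[rotated], simp)+
  have "s \<le> a" using inf_eq_ge(1)[OF assms(2)] .
  have "(a \<squnion> x) \<sqinter> (a \<squnion> c) = a" "(a \<squnion> y) \<sqinter> (a \<squnion> c) = a"
    using modular_law[of a "a \<squnion> c" x] modular_law[of a "a \<squnion> c" y] m c \<open>s \<le> a\<close>
    by (simp_all add: sup.absorb1)
  moreover have "a \<squnion> x \<squnion> (a \<squnion> c) = a \<squnion> (x \<squnion> c)" "a \<squnion> y \<squnion> (a \<squnion> c) = a \<squnion> (y \<squnion> c)"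
    by (simp_all add: ac_simps)
  ultimately show ?thesis using c by (intro perspectiveI[of _ "a \<squnion> c"]) simp_all
qed


section \<open>Projective intervals\<close>

definition transposes_up :: "'a::lattice \<times> 'a \<Rightarrow> 'a \<times> 'a \<Rightarrow> bool" where
  "transposes_up I J \<longleftrightarrow> snd I \<sqinter> fst J = fst I \<and> snd I \<squnion> fst J = snd J"

text \<open>
  The parameter \<open>s\<close> records a common lower bound for all the intervals passed on the way.  With such a
  bound, each of them can be replaced by an interval starting at \<open>s\<close>.
\<close>

definition projective_above :: "'a::lattice \<Rightarrow> 'a \<times> 'a \<Rightarrow> 'a \<times> 'a \<Rightarrow> bool" where
  "projective_above s =
     (\<lambda>I J. s \<le> fst I \<and> s \<le> fst J \<and> (transposes_up I J \<or> transposes_up J I))\<^sup>*\<^sup>*"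

definition projective :: "'a::lattice \<times> 'a \<Rightarrow> 'a \<times> 'a \<Rightarrow> bool" where
  "projective I J \<longleftrightarrow> (\<exists>s. projective_above s I J)"

lemma projective_above_antimono:
  assumes "projective_above s I J" "t \<le> s"
  shows "projective_above t I J"
  using assms unfolding projective_above_def
  by (elim rtranclp_mono[THEN predicate2D, rotated]) (auto intro: order.trans)

lemma projective_above_sym: "projective_above s I J \<Longrightarrow> projective_above s J I"
  unfolding projective_above_def
  by (rule sympD[OF symp_rtranclp]) (auto intro: sympI)

lemma projective_refl: "projective I I"
  unfolding projective_def projective_above_def by blast

lemma projective_sym: "projective I J \<Longrightarrow> projective J I"
  unfolding projective_def using projective_above_sym by blast

lemma projective_trans:
  assumes "projective I J" "projective J K"
  shows "projective I K"
proof -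
  obtain s t where "projective_above s I J" "projective_above t J K"
    using assms unfolding projective_def by blast
  then have "projective_above (s \<sqinter> t) I J" "projective_above (s \<sqinter> t) J K"
    using projective_above_antimono by (metis inf_le1 inf_le2)+
  then show ?thesis
    unfolding projective_def projective_above_def by (blast intro: rtranclp_trans)
qed

lemma transposes_up_imp_projective:
  assumes "transposes_up I J"
  shows "projective I J"
proof -
  have "fst I \<le> fst J" using assms unfolding transposes_up_def by (metis inf_le2)
  then have "projective_above (fst I) I J"
    using assms unfolding projective_above_def by (intro r_into_rtranclp) auto
  then show ?thesis unfolding projective_def ..
qed

text \<open>
  Transposition is an isomorphism of intervals, so subintervals can be followed along the way.
\<close>

lemma projective_restrict:
  fixes a b c d x :: "'a::modular_lattice"
  assumes "projective (a, b) (c, d)" "a \<le> x" "x \<le> b"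
  obtains y where "c \<le> y" "y \<le> d" "projective (a, x) (c, y)"
proof -
  obtain s where "projective_above s (a, b) (c, d)"
    using assms unfolding projective_def by blast
  then have "\<exists>y. c \<le> y \<and> y \<le> d \<and> projective (a, x) (c, y)"
    unfolding projective_above_def
  proof (induction "(c, d)" arbitrary: c d rule: rtranclp_induct)
    case base
    then show ?case using assms projective_refl by blast
  next
    case (step J e f)
    obtain c d where J: "J = (c, d)" by fastforce
    obtain y where y: "c \<le> y" "y \<le> d" "projective (a, x) (c, y)"
      using step(3)[OF J] by blast
    from step(2) consider "transposes_up (c, d) (e, f)" | "transposes_up (e, f) (c, d)"
      unfolding J by blast
    then show ?case
    proof cases
      case 1
      then have m: "d \<sqinter> e = c" "d \<squnion> e = f" unfolding transposes_up_def by simp_all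
      have "y \<sqinter> e = c" using m(1) y(1,2)
        by (metis inf.absorb1 inf.absorb2 inf.assoc inf.left_commute)
      then have "transposes_up (c, y) (e, y \<squnion> e)" unfolding transposes_up_def by simp
      moreover have "y \<squnion> e \<le> f" using m(2) y(2) by (metis order.refl sup_mono)
      ultimately show ?thesis
        using projective_trans[OF y(3) transposes_up_imp_projective] by (metis sup_ge2)
    next
      case 2
      then have m: "f \<sqinter> c = e" "f \<squnion> c = d" unfolding transposes_up_def by simp_all
      have "c \<squnion> (f \<sqinter> y) = y"
        using modular_law[OF y(1), of f] m(2) y(2) by (simp add: sup_commute inf.absorb2)
      moreover have "f \<sqinter> y \<sqinter> c = e" using m(1) y(1) by (metis inf.absorb2 inf.assoc)
      ultimately have "transposes_up (e, f \<sqinter> y) (c, y)"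
        unfolding transposes_up_def by (simp add: sup_commute)
      moreover have "e \<le> f \<sqinter> y" using \<open>f \<sqinter> y \<sqinter> c = e\<close> by (metis inf_le1)
      ultimately show ?thesis
        using projective_trans[OF y(3) projective_sym[OF transposes_up_imp_projective]]
        by (metis inf_le1)
    qed
  qed
  then show thesis using that by blast
qed

lemma projective_degenerate_iff:
  assumes "projective I J"
  shows "fst I = snd I \<longleftrightarrow> fst J = snd J"
proof -
  have *: "fst I = snd I \<longleftrightarrow> fst J = snd J" if "transposes_up I J" for I J :: "'a \<times> 'a"
    using that inf.absorb_iff1[of "snd I" "fst J"] sup.absorb_iff2[of "snd I" "fst J"]
    unfolding transposes_up_def by auto
  obtain s where "projective_above s I J" using assms unfolding projective_def by blast
  then show ?thesis
    unfolding projective_above_def by (induction rule: rtranclp_induct) (use * in blast)+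
qed

text \<open>
  A complement \<open>p\<close> of \<open>u\<close> in \<open>[s, v]\<close> gives an interval \<open>[s, p]\<close> that transposes up to \<open>[u, v]\<close>, hence
  also to every interval to which \<open>[u, v]\<close> transposes up.
\<close>

lemma complement_transposes_up:
  assumes "transposes_up (u, v) (u', v')" "p \<sqinter> u = s" "p \<squnion> u = v"
  shows "p \<sqinter> u' = s" "p \<squnion> u' = v'"
proof -
  have m: "v \<sqinter> u' = u" "v \<squnion> u' = v'" using assms(1) unfolding transposes_up_def by simp_all
  show "p \<sqinter> u' = s" using m(1) assms(2,3) by (metis inf.absorb1 inf.assoc sup_ge1)
  show "p \<squnion> u' = v'" using m assms(3) by (metis inf_le2 sup.absorb2 sup.assoc)
qed

text \<open>
  Choosing for every interval \<open>[u, v]\<close> on the way a complement of \<open>u\<close> in \<open>[s, v]\<close> turns the chain of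
  transpositions into a chain of perspectivities over \<open>s\<close>, which is then shortened by passing to
  parts.
\<close>

lemma complements_of_projective:
  fixes s :: "'a::modular_lattice"
  assumes rc: "relatively_complemented_on (UNIV :: 'a set)"
    and "projective_above s (u, v) (u', v')"
    and "p \<sqinter> u = s" "p \<squnion> u = v" "p \<noteq> s" "p' \<sqinter> u' = s" "p' \<squnion> u' = v'"
  shows "perspective_parts s p p'"
  using assms(2-) unfolding projective_above_def
proof (induction "(u, v)" arbitrary: u v p rule: converse_rtranclp_induct)
  case base
  then have "perspective s p p'" by (intro perspectiveI[of _ u']) auto
  then show ?case using base unfolding perspective_parts_def by blast
next
  case (step K)
  obtain w x where K: "K = (w, x)" by fastforce
  from step(1) K have tr: "transposes_up (u, v) (w, x) \<or> transposes_up (w, x) (u, v)"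
    and "s \<le> w" by auto
  have "w \<le> x" using tr unfolding transposes_up_def by (metis fst_conv snd_conv inf_le1 sup_ge2)
  obtain q where q: "q \<sqinter> w = s" "q \<squnion> w = x"
    using relative_complement[OF rc \<open>s \<le> w\<close> \<open>w \<le> x\<close>] by (metis inf_commute sup_commute)
  have pq: "perspective s p q"
    using tr
  proof
    assume "transposes_up (u, v) (w, x)"
    from complement_transposes_up[OF this step(4,5)] show ?thesis
      using q by (intro perspectiveI[of _ w]) auto
  next
    assume "transposes_up (w, x) (u, v)"
    from complement_transposes_up[OF this q] show ?thesis
      using step by (intro perspectiveI[of _ u]) auto
  qed
  then have "q \<noteq> s" using step(6) perspective_bottom_iff by blast
  from step(3)[OF K q this step(7,8)] obtain q0 r where
    q0: "q0 \<le> q" "r \<le> p'" "q0 \<noteq> s" "perspective s q0 r" unfolding perspective_parts_def by blast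
  obtain p0 where p0: "p0 \<le> p" "perspective s q0 p0"
    using perspective_restrict[OF perspective_sym[OF pq] _ q0(1)] q0(4) perspective_ge by blast
  have "perspective_parts s p0 r"
    using perspective_parts_trans[OF rc perspective_sym[OF p0(2)] q0(4)] q0(3) p0(2)
      perspective_bottom_iff by blast
  then show ?case using perspective_parts_mono p0(1) q0(2) by blast
qed

text \<open>
  The chain of transpositions need not stay above \<open>a\<close>, so perspective parts are first found over a
  lower element \<open>s\<close>, inside complements \<open>x, y\<close> of \<open>a\<close>.  Since \<open>p \<sqinter> q = a\<close>, the triple \<open>a, x, y\<close> is
  independent over \<open>s\<close>, and the perspectivity can be shifted back up to \<open>a\<close>.
\<close>

lemma projective_imp_perspective_parts:
  fixes a :: "'a::modular_lattice"
  assumes rc: "relatively_complemented_on (UNIV :: 'a set)"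
    and "projective (a, p) (a, q)" "p \<noteq> a" "p \<sqinter> q = a"
  shows "perspective_parts a p q"
proof -
  obtain s0 where s0: "projective_above s0 (a, p) (a, q)"
    using assms unfolding projective_def by blast
  define s where "s = s0 \<sqinter> a"
  have proj: "projective_above s (a, p) (a, q)" and "s \<le> a"
    using projective_above_antimono[OF s0] unfolding s_def by auto
  have ge: "a \<le> p" "a \<le> q" using inf_eq_ge[OF assms(4)] .
  obtain x where x: "x \<sqinter> a = s" "x \<squnion> a = p"
    using relative_complement[OF rc \<open>s \<le> a\<close> ge(1)] by (metis inf_commute sup_commute)
  obtain y where y: "y \<sqinter> a = s" "y \<squnion> a = q"
    using relative_complement[OF rc \<open>s \<le> a\<close> ge(2)] by (metis inf_commute sup_commute)
  have "x \<noteq> s" using x \<open>s \<le> a\<close> assms(3) sup.absorb2 by blast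
  then obtain x' y' where p: "x' \<le> x" "y' \<le> y" "x' \<noteq> s" "perspective s x' y'"
    using complements_of_projective[OF rc proj x _ y] unfolding perspective_parts_def by blast
  have "y \<sqinter> (x \<squnion> a) = s"
    using inf_cut[of y q p a] x(2) y assms(4) by (metis sup_ge1)
  then have "a \<sqinter> (y \<squnion> x) = s" using independent_rotate x(1) by blast
  moreover have "x' \<squnion> y' \<le> y \<squnion> x" using p by (simp add: le_supI1 le_supI2)
  moreover have "s \<le> x'" using p(4) perspective_ge by blast
  ultimately have "a \<sqinter> (x' \<squnion> y') = s"
    using \<open>s \<le> a\<close> inf_eq_mono[of a "y \<squnion> x" s a "x' \<squnion> y'"] by (simp add: le_supI1)
  then have "perspective a (a \<squnion> x') (a \<squnion> y')" using perspective_shift[OF p(4)] by blast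
  moreover have "a \<squnion> x' \<noteq> a"
  proof
    assume "a \<squnion> x' = a"
    then have "x' \<le> a" by (metis sup_ge2)
    then have "x' \<le> s" using p(1) x(1) by (metis le_inf_iff)
    then show False using p(3) \<open>s \<le> x'\<close> by simp
  qed
  moreover have "a \<squnion> x' \<le> p" "a \<squnion> y' \<le> q"
    using p(1,2) x(2) y(2) by (auto intro: le_supI1)
  ultimately show ?thesis unfolding perspective_parts_def by blast
qed


section \<open>Independent families\<close>

text \<open>
  Inserting \<open>s\<close> makes the join defined for \<open>A = {}\<close>, where no bottom element is available.
\<close>

definition join_over :: "'a::lattice \<Rightarrow> (nat \<Rightarrow> 'a) \<Rightarrow> nat set \<Rightarrow> 'a" where
  "join_over s z A = \<Squnion>\<^sub>f\<^sub>i\<^sub>n (insert s (z ` A))"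

lemma join_over_upper: "finite A \<Longrightarrow> i \<in> A \<Longrightarrow> z i \<le> join_over s z A"
  and join_over_base: "finite A \<Longrightarrow> s \<le> join_over s z A"
  unfolding join_over_def by (auto intro: Sup_fin.coboundedI)

lemma join_over_least:
  "finite A \<Longrightarrow> s \<le> b \<Longrightarrow> (\<And>i. i \<in> A \<Longrightarrow> z i \<le> b) \<Longrightarrow> join_over s z A \<le> b"
  unfolding join_over_def by (intro Sup_fin.boundedI) auto

lemma join_over_mono:
  assumes "finite B" "A \<subseteq> B"
  shows "join_over s z A \<le> join_over s z B"
  using assms by (intro join_over_least) (auto intro: join_over_upper join_over_base finite_subset)

lemma join_over_empty: "join_over s z {} = s"
  unfolding join_over_def by simp

lemma join_over_insert:
  assumes "finite A"
  shows "join_over s z (insert i A) = z i \<squnion> join_over s z A"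
proof (rule order.antisym)
  show "join_over s z (insert i A) \<le> z i \<squnion> join_over s z A"
    using assms by (intro join_over_least) (auto intro: le_supI1 le_supI2 join_over_upper join_over_base)
  show "z i \<squnion> join_over s z A \<le> join_over s z (insert i A)"
    using assms by (intro le_supI join_over_mono join_over_upper) auto
qed

text \<open>
  The sequential form of independence, convenient for inductive constructions; in modular lattices it
  implies the symmetric form, \<open>independent_over_disjoint\<close>.
\<close>

definition independent_over :: "'a::lattice \<Rightarrow> (nat \<Rightarrow> 'a) \<Rightarrow> nat \<Rightarrow> bool" where
  "independent_over s z n \<longleftrightarrow> (\<forall>i<n. join_over s z {..<i} \<sqinter> z i = s)"

lemma independent_overD: "independent_over s z n \<Longrightarrow> i < n \<Longrightarrow> join_over s z {..<i} \<sqinter> z i = s"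
  unfolding independent_over_def by blast

lemma independent_over_ge: "independent_over s z n \<Longrightarrow> i < n \<Longrightarrow> s \<le> z i"
  using independent_overD inf_eq_ge(2) by metis

lemma independent_over_shrink:
  assumes "independent_over s z n" "\<And>i. i < n \<Longrightarrow> s \<le> w i" "\<And>i. i < n \<Longrightarrow> w i \<le> z i" "m \<le> n"
  shows "independent_over s w m"
  unfolding independent_over_def
proof (intro allI impI)
  fix i assume "i < m"
  then have "i < n" using assms(4) by simp
  have "join_over s w {..<i} \<le> join_over s z {..<i}"
  proof (rule join_over_least)
    fix j assume "j \<in> {..<i}"
    then have "w j \<le> z j" "z j \<le> join_over s z {..<i}"
      using assms(3) \<open>i < n\<close> by (auto intro: join_over_upper)
    then show "w j \<le> join_over s z {..<i}" by (rule order.trans)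
  qed (auto intro: join_over_base)
  then show "join_over s w {..<i} \<sqinter> w i = s"
    using inf_eq_mono[OF independent_overD[OF assms(1) \<open>i < n\<close>]] assms(2,3) \<open>i < n\<close>
    by (simp add: join_over_base)
qed

lemma independent_over_disjoint:
  fixes s :: "'a::modular_lattice"
  assumes "independent_over s z n" "A \<subseteq> {..<n}" "B \<subseteq> {..<n}" "A \<inter> B = {}"
  shows "join_over s z A \<sqinter> join_over s z B = s"
  using assms
proof (induction n arbitrary: A B)
  case 0
  then show ?case by (simp add: join_over_empty)
next
  case (Suc n)
  have ind: "independent_over s z n" using Suc.prems(1) unfolding independent_over_def by simp
  have top: "join_over s z A \<sqinter> join_over s z B = s"
    if AB: "A \<subseteq> {..<n}" "B \<subseteq> {..<Suc n}" "A \<inter> B = {}" "n \<in> B" for A B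
  proof -
    let ?B = "B - {n}"
    have fin: "finite A" "finite ?B" using AB finite_subset by blast+
    have sub: "?B \<subseteq> {..<n}" using AB(2) by auto
    have B: "join_over s z B = z n \<squnion> join_over s z ?B"
      using join_over_insert[OF fin(2)] AB(4) by (metis insert_Diff)
    have "join_over s z ?B \<le> join_over s z {..<n}" by (intro join_over_mono sub) simp
    from modular_law[OF this, of "z n"]
    have "join_over s z B \<sqinter> join_over s z {..<n} = join_over s z ?B \<squnion> (z n \<sqinter> join_over s z {..<n})"
      unfolding B by (simp add: sup_commute)
    also have "\<dots> = join_over s z ?B"
      using independent_overD[OF Suc.prems(1), of n] join_over_base[OF fin(2), of s z]
      by (simp add: inf_commute sup.absorb1 sup.absorb2)
    finally have "join_over s z A \<sqinter> join_over s z B = join_over s z A \<sqinter> join_over s z ?B"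
      by (rule inf_cut[rotated]) (intro join_over_mono AB(1), simp)
    also have "\<dots> = s" using AB by (intro Suc.IH[OF ind] sub) auto
    finally show ?thesis .
  qed
  show ?case
  proof (cases "n \<in> A")
    case True
    then have "n \<notin> B" using Suc.prems(4) by blast
    then have "B \<subseteq> {..<n}" using Suc.prems(3) by (simp add: lessThan_Suc subset_insert)
    then have "join_over s z B \<sqinter> join_over s z A = s"
      using top[OF _ Suc.prems(2) _ True] Suc.prems(4) by blast
    then show ?thesis by (simp add: inf_commute)
  next
    case False
    then have A: "A \<subseteq> {..<n}" using Suc.prems(2) by (simp add: lessThan_Suc subset_insert)
    show ?thesis
    proof (cases "n \<in> B")
      case True
      then show ?thesis using top A Suc.prems by blast
    next
      case False
      then have "B \<subseteq> {..<n}" using Suc.prems(3) by (simp add: lessThan_Suc subset_insert)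
      then show ?thesis using Suc.IH[OF ind A] Suc.prems by blast
    qed
  qed
qed

text \<open>
  The proof tests the law at the join \<open>x\<close> of axes \<open>c\<^sub>i \<le> z\<^sub>0 \<squnion> z\<^sub>i\<close> and at the joins \<open>y\<^sub>i\<close> of all
  members but \<open>z\<^sub>i\<close>.  The meet of all \<open>y\<^sub>i\<close> is \<open>s\<close>, so the left-hand side is \<open>x\<close>, which is disjoint
  from \<open>z\<^sub>0\<close>.  On the right, \<open>z\<^sub>i\<close> is below the meet of the \<open>y\<^sub>j\<close> with \<open>j \<noteq> i\<close>, and
  \<open>z\<^sub>0 \<le> c\<^sub>i \<squnion> z\<^sub>i\<close>; so \<open>z\<^sub>0\<close> is below the right-hand side.
\<close>

lemma homogeneous_family_not_n_distributive:
  fixes s :: "'a::modular_lattice"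
  assumes indep: "independent_over s z (Suc n)" and "n \<ge> 1" and "z 0 \<noteq> s"
    and le: "\<And>i. i \<le> n \<Longrightarrow> z i \<le> b"
    and persp: "\<And>i. 1 \<le> i \<Longrightarrow> i \<le> n \<Longrightarrow> perspective s (z 0) (z i)"
  shows "\<not> n_distributive_on n {s..b}"
proof
  assume dist: "n_distributive_on n {s..b}"
  have "\<forall>i. \<exists>c. 1 \<le> i \<and> i \<le> n \<longrightarrow>
      c \<le> z 0 \<squnion> z i \<and> z 0 \<sqinter> c = s \<and> z 0 \<le> z i \<squnion> c"
    using persp perspective_axis_below_join by (metis sup_ge1)
  then obtain c where c: "\<And>i. 1 \<le> i \<Longrightarrow> i \<le> n \<Longrightarrow>
      c i \<le> z 0 \<squnion> z i \<and> z 0 \<sqinter> c i = s \<and> z 0 \<le> z i \<squnion> c i"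
    by metis
  define x where "x = join_over s c {1..n}"
  define y where "y i = join_over s z ({..n} - {i})" for i
  define p where "p = \<Sqinter>\<^sub>f\<^sub>i\<^sub>n (y ` {i. i \<le> n})"
  have s0: "s \<le> z 0" using independent_over_ge[OF indep] by simp
  have "s \<le> b" using s0 le[of 0] by simp
  have cb: "c i \<le> b" if "1 \<le> i" "i \<le> n" for i
    using c[OF that] le[of 0] le[of i] that by (metis le_supI order.trans zero_le)
  have x_in: "x \<in> {s..b}"
    unfolding x_def using \<open>s \<le> b\<close> cb by (auto intro: join_over_base join_over_least)
  have y_in: "y i \<in> {s..b}" for i
    unfolding y_def using \<open>s \<le> b\<close> le by (auto intro: join_over_base join_over_least)
  \<comment> \<open>each new axis meets the join of the earlier members trivially, so it adds nothing below them\<close>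
  have "z 0 \<sqinter> join_over s c {1..m} = s" if "m \<le> n" for m
    using that
  proof (induction m)
    case 0
    then show ?case using s0 by (simp add: join_over_empty inf.absorb2)
  next
    case (Suc m)
    let ?X = "join_over s c {1..m}" and ?Z = "join_over s z {..<Suc m}"
    have ins: "join_over s c {1..Suc m} = c (Suc m) \<squnion> ?X"
      using join_over_insert[of "{1..m}"] by (simp add: atLeastAtMostSuc_conv)
    have z0: "z 0 \<le> ?Z" by (intro join_over_upper) auto
    have XZ: "?X \<le> ?Z"
    proof (rule join_over_least)
      fix i assume i: "i \<in> {1..m}"
      then have "c i \<le> z 0 \<squnion> z i" using c Suc.prems by simp
      also have "\<dots> \<le> ?Z" using i by (intro le_supI join_over_upper) auto
      finally show "c i \<le> ?Z" .
    qed (auto intro: join_over_base)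
    have cS: "c (Suc m) \<le> z 0 \<squnion> z (Suc m)" "z 0 \<sqinter> c (Suc m) = s" using c Suc.prems by simp_all
    have "?Z \<sqinter> (z 0 \<squnion> z (Suc m)) = z 0"
      using modular_law[OF z0, of "z (Suc m)"] independent_overD[OF indep, of "Suc m"] Suc.prems s0
      by (simp add: inf_commute sup.absorb1)
    then have "c (Suc m) \<sqinter> ?Z = s" using inf_cut[OF cS(1)] cS(2) by (metis inf_commute)
    then have "(c (Suc m) \<squnion> ?X) \<sqinter> ?Z = ?X"
      using modular_law[OF XZ, of "c (Suc m)"] join_over_base[of "{1..m}" s c]
      by (simp add: sup_commute sup.absorb1 sup.absorb2)
    then have "z 0 \<sqinter> (c (Suc m) \<squnion> ?X) = z 0 \<sqinter> ?X" by (rule inf_cut[OF z0])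
    then show ?case using Suc ins by simp
  qed
  then have zx: "z 0 \<sqinter> x = s" unfolding x_def by simp
  \<comment> \<open>meeting with \<open>y m\<close> removes the member \<open>z m\<close> from the join\<close>
  have "p \<le> join_over s z {m..n}" if "m \<le> Suc n" for m
    using that
  proof (induction m)
    case 0
    have "p \<le> y 0" unfolding p_def by (intro Inf_fin.coboundedI) auto
    also have "\<dots> \<le> join_over s z {0..n}" unfolding y_def by (intro join_over_mono) auto
    finally show ?case .
  next
    case (Suc m)
    let ?T = "join_over s z {Suc m..n}"
    have "{m..n} = insert m {Suc m..n}" using Suc.prems by auto
    then have ins: "join_over s z {m..n} = z m \<squnion> ?T" by (metis join_over_insert finite_atLeastAtMost)
    have "join_over s z {m} \<sqinter> y m = s"
      unfolding y_def using Suc.prems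
      by (intro independent_over_disjoint[OF indep]) auto
    then have zy: "z m \<sqinter> y m = s"
      using join_over_insert[of "{}" s z m] independent_over_ge[OF indep, of m] Suc.prems
      by (simp add: join_over_empty sup.absorb1)
    have Ty: "?T \<le> y m" unfolding y_def by (intro join_over_mono) auto
    have "p \<le> y m" unfolding p_def using Suc.prems by (intro Inf_fin.coboundedI) auto
    then have "p \<le> (?T \<squnion> z m) \<sqinter> y m" using Suc ins by (simp add: sup_commute)
    also have "\<dots> = ?T"
      using modular_law[OF Ty, of "z m"] zy join_over_base[of "{Suc m..n}" s z]
      by (simp add: sup.absorb1)
    finally show ?case .
  qed
  from this[of "Suc n"] have "p \<le> s" by (simp add: join_over_empty)
  then have "p \<le> x" using x_in by (auto intro: order.trans)
  then have xp: "x \<squnion> p = x" by (rule sup.absorb1)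
  have "z 0 \<le> \<Sqinter>\<^sub>f\<^sub>i\<^sub>n ((\<lambda>i. x \<squnion> \<Sqinter>\<^sub>f\<^sub>i\<^sub>n (y ` {j. j \<le> n \<and> j \<noteq> i})) ` {i. i \<le> n})"
  proof (intro Inf_fin.boundedI)
    fix q assume "q \<in> (\<lambda>i. x \<squnion> \<Sqinter>\<^sub>f\<^sub>i\<^sub>n (y ` {j. j \<le> n \<and> j \<noteq> i})) ` {i. i \<le> n}"
    then obtain i where i: "i \<le> n" and q: "q = x \<squnion> \<Sqinter>\<^sub>f\<^sub>i\<^sub>n (y ` {j. j \<le> n \<and> j \<noteq> i})" by auto
    have "(if i = 0 then 1 else 0) \<in> {j. j \<le> n \<and> j \<noteq> i}" using \<open>n \<ge> 1\<close> by auto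
    then have "z i \<le> \<Sqinter>\<^sub>f\<^sub>i\<^sub>n (y ` {j. j \<le> n \<and> j \<noteq> i})"
      using i unfolding y_def by (intro Inf_fin.boundedI) (auto intro!: join_over_upper)
    then have "x \<squnion> z i \<le> q" unfolding q by (rule sup_mono[OF order.refl])
    moreover have "z 0 \<le> x \<squnion> z i"
    proof (cases "i = 0")
      case False
      then have "c i \<le> x" unfolding x_def using i by (intro join_over_upper) auto
      then have "z i \<squnion> c i \<le> x \<squnion> z i" by (simp add: le_supI1)
      then show ?thesis using c[of i] False i order.trans by (metis less_one not_le)
    qed simp
    ultimately show "z 0 \<le> q" by order
  qed auto
  also have "\<dots> = x \<squnion> p"
    unfolding p_def
    by (rule dist[unfolded n_distributive_on_def, rule_format, OF x_in, symmetric]) (rule y_in)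
  finally have "z 0 \<le> x" using xp by simp
  then have "z 0 = s" using zx by (simp add: inf.absorb1)
  with \<open>z 0 \<noteq> s\<close> show False ..
qed

text \<open>
  Members are treated one at a time.  Given a part \<open>w 0\<close> of \<open>z 0\<close> that is perspective to parts of the
  earlier members, projectivity carries it into the next member, where a smaller part of \<open>w 0\<close>
  acquires a perspective copy; the earlier perspectivities restrict to the smaller part.
\<close>

lemma homogeneous_refinement:
  fixes a :: "'a::modular_lattice"
  assumes rc: "relatively_complemented_on (UNIV :: 'a set)"
    and indep: "independent_over a z m"
    and proj: "\<And>i. i < m \<Longrightarrow> projective (a, z i) I" and I: "fst I \<noteq> snd I"
    and "1 \<le> k" "k \<le> m"
  shows "\<exists>w. (\<forall>i<k. a \<le> w i \<and> w i \<le> z i) \<and> w 0 \<noteq> a \<and> 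
             (\<forall>i. 1 \<le> i \<and> i < k \<longrightarrow> perspective a (w 0) (w i))"
  using \<open>1 \<le> k\<close> \<open>k \<le> m\<close>
proof (induction k rule: nat_induct_at_least)
  case base
  then show ?case
    using projective_degenerate_iff[OF proj[of 0]] I independent_over_ge[OF indep]
    by (intro exI[of _ z]) auto
next
  case (Suc k)
  then obtain w where w: "\<And>i. i < k \<Longrightarrow> a \<le> w i \<and> w i \<le> z i" "w 0 \<noteq> a"
    "\<And>i. 1 \<le> i \<Longrightarrow> i < k \<Longrightarrow> perspective a (w 0) (w i)" by auto
  have "0 < k" using Suc.hyps by simp
  have "projective (a, z 0) (a, z k)"
    using projective_trans[OF proj projective_sym[OF proj]] Suc.prems by simp
  then obtain y where y: "a \<le> y" "y \<le> z k" "projective (a, w 0) (a, y)"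
    using projective_restrict w(1)[OF \<open>0 < k\<close>] by metis
  have "z 0 \<le> join_over a z {..<k}" using \<open>0 < k\<close> by (intro join_over_upper) auto
  then have "w 0 \<sqinter> y = a"
    using inf_eq_mono[OF independent_overD[OF indep, of k]] w(1)[OF \<open>0 < k\<close>] y(1,2) Suc.prems
    by (meson Suc_le_lessD order.trans)
  then obtain w0 y' where w0: "w0 \<le> w 0" "y' \<le> y" "w0 \<noteq> a" "perspective a w0 y'"
    using projective_imp_perspective_parts[OF rc y(3) w(2)] unfolding perspective_parts_def by blast
  then have ge: "a \<le> w0" "a \<le> y'" using perspective_ge by blast+
  have "\<forall>i. \<exists>v. 1 \<le> i \<and> i < k \<longrightarrow> v \<le> w i \<and> perspective a w0 v"
    using perspective_restrict[OF w(3) ge(1) w0(1)] by metis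
  then obtain v where v: "\<And>i. 1 \<le> i \<Longrightarrow> i < k \<Longrightarrow> v i \<le> w i \<and> perspective a w0 (v i)" by metis
  define u where "u i = (if i = 0 then w0 else if i = k then y' else v i)" for i
  have "a \<le> u i \<and> u i \<le> z i \<and> (1 \<le> i \<longrightarrow> perspective a w0 (u i))" if "i < Suc k" for i
  proof -
    have "i = 0 \<or> i = k \<and> i \<noteq> 0 \<or> 1 \<le> i \<and> i < k" using that by auto
    then consider "i = 0" | "i = k" "i \<noteq> 0" | "1 \<le> i" "i < k" by blast
    then show ?thesis
    proof cases
      case 1
      then show ?thesis unfolding u_def using ge w0 w(1)[OF \<open>0 < k\<close>] by auto
    next
      case 2
      then show ?thesis unfolding u_def using ge w0 y by auto
    next
      case 3
      then show ?thesis unfolding u_def using v[OF 3] w(1)[of i] perspective_ge[of a w0 "v i"] by auto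
    qed
  qed
  moreover have "u 0 = w0" unfolding u_def by simp
  ultimately show ?case using w0(3) by (intro exI[of _ u]) auto
qed


section \<open>Packings by projective copies of an interval\<close>

text \<open>
  An independent family of copies of \<open>I\<close> over \<open>a\<close> is recorded by its join \<open>e\<close> and its size only, so that no
  reindexing is needed when families are joined.
\<close>

inductive packed :: "'a::lattice \<times> 'a \<Rightarrow> 'a \<Rightarrow> 'a \<Rightarrow> nat \<Rightarrow> bool" for I where
  empty: "packed I a a 0"
| step: "packed I a e k \<Longrightarrow> e \<sqinter> z = a \<Longrightarrow> projective (a, z) I \<Longrightarrow> packed I a (e \<squnion> z) (Suc k)"

lemma packed_ge: "packed I a e k \<Longrightarrow> a \<le> e"
  by (induction rule: packed.induct) (auto intro: le_supI1)

text \<open>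
  Packings are carried along the isomorphisms \<open>[a \<sqinter> b, b] \<cong> [a, a \<squnion> b]\<close> in both directions.
\<close>

lemma packed_transpose_up:
  fixes a b :: "'a::modular_lattice"
  assumes "packed I (a \<sqinter> b) e k" "e \<le> b"
  shows "packed I a (a \<squnion> e) k"
  using assms
proof (induction "a \<sqinter> b" e k rule: packed.induct)
  case empty
  then show ?case using packed.empty[of I a] by (simp add: sup.absorb1)
next
  case (step e k z)
  then have le: "e \<le> b" "z \<le> b" and IH: "packed I a (a \<squnion> e) k" by auto
  have ge: "a \<sqinter> b \<le> z" using inf_eq_ge[OF step(3)] by blast
  have "(a \<squnion> z) \<sqinter> b = z"
    using modular_law[OF le(2), of a] ge by (simp add: sup_commute sup.absorb1 sup.absorb2)
  then have "e \<sqinter> (a \<squnion> z) = a \<sqinter> b" using inf_cut[OF le(1)] step(3) by metis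
  then have meet: "(a \<squnion> e) \<sqinter> (a \<squnion> z) = a"
    using modular_law[of a "a \<squnion> z" e] by (simp add: sup.absorb1)
  have "transposes_up (a \<sqinter> b, z) (a, a \<squnion> z)"
  proof -
    have "z \<sqinter> a = a \<sqinter> b" by (rule order.antisym) (use ge le(2) in \<open>auto intro: le_infI1\<close>)
    then show ?thesis unfolding transposes_up_def by (simp add: sup_commute)
  qed
  then have proj: "projective (a, a \<squnion> z) I"
    using projective_trans[OF projective_sym[OF transposes_up_imp_projective]] step(4) by blast
  have "(a \<squnion> e) \<squnion> (a \<squnion> z) = a \<squnion> (e \<squnion> z)" by (simp add: ac_simps)
  with packed.step[OF IH meet proj] show ?case by metis
qed

lemma packed_transpose_down:
  fixes a b :: "'a::modular_lattice"
  assumes "packed I a e k" "e \<le> a \<squnion> b"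
  shows "packed I (a \<sqinter> b) (e \<sqinter> b) k"
  using assms
proof (induction a e k rule: packed.induct)
  case (empty a)
  then show ?case using packed.empty[of I "a \<sqinter> b"] by simp
next
  case (step a e k z)
  then have le: "e \<le> a \<squnion> b" "z \<le> a \<squnion> b" and IH: "packed I (a \<sqinter> b) (e \<sqinter> b) k" by auto
  have ge: "a \<le> e" "a \<le> z" using inf_eq_ge[OF step(2)] by blast+
  have split: "u = a \<squnion> (b \<sqinter> u)" if "a \<le> u" "u \<le> a \<squnion> b" for u
    using modular_law[OF that(1), of b] that(2) by (simp add: inf.absorb2)
  have "e \<squnion> z = ((e \<sqinter> b) \<squnion> (z \<sqinter> b)) \<squnion> a"
    using split[OF ge(1) le(1)] split[OF ge(2) le(2)] by (metis inf_commute sup.assoc sup.commute sup.left_idem)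
  moreover have "a \<sqinter> b \<le> (e \<sqinter> b) \<squnion> (z \<sqinter> b)" using ge(1) by (intro le_supI1 inf_mono) auto
  moreover have "(e \<sqinter> b) \<squnion> (z \<sqinter> b) \<le> b" by simp
  ultimately have eq: "(e \<squnion> z) \<sqinter> b = (e \<sqinter> b) \<squnion> (z \<sqinter> b)"
    using modular_law[of "(e \<sqinter> b) \<squnion> (z \<sqinter> b)" b a] by (simp add: sup.absorb1)
  have "transposes_up (a \<sqinter> b, z \<sqinter> b) (a, z)"
    unfolding transposes_up_def using split[OF ge(2) le(2)] inf_drop[OF ge(2), of b]
    by (simp add: ac_simps)
  then have "projective (a \<sqinter> b, z \<sqinter> b) I"
    using projective_trans[OF transposes_up_imp_projective step(3)] by blast
  moreover have "(e \<sqinter> b) \<sqinter> (z \<sqinter> b) = a \<sqinter> b" unfolding step(2)[symmetric] by (simp add: ac_simps)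
  ultimately show ?case using packed.step[OF IH] eq by simp
qed

text \<open>
  If the joins of two independent families are disjoint, their union is independent: induction on
  the second family, modularity giving \<open>(e \<squnion> f) \<sqinter> (f \<squnion> z) = f\<close>.
\<close>

lemma packed_join:
  fixes a :: "'a::modular_lattice"
  assumes "packed I a f l" "packed I a e k" "e \<sqinter> f = a"
  shows "packed I a (e \<squnion> f) (k + l)"
  using assms
proof (induction a f l rule: packed.induct)
  case (empty a)
  then show ?case using packed_ge by (fastforce simp: sup.absorb1)
next
  case (step a f l z)
  have ge: "a \<le> e" "a \<le> f" "a \<le> z" 
    using inf_eq_ge[OF step(2)] inf_eq_ge[OF \<open>e \<sqinter> (f \<squnion> z) = a\<close>] by auto
  have ef: "e \<sqinter> f = a" using inf_eq_mono[OF step.prems(2) ge(1) order.refl ge(2)] by simp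
  have "f \<squnion> (e \<sqinter> (f \<squnion> z)) = (f \<squnion> e) \<sqinter> (f \<squnion> z)" by (rule modular_law) simp
  then have "(e \<squnion> f) \<sqinter> (f \<squnion> z) = f" using step.prems(2) ge by (simp add: sup_commute sup.absorb1 sup.absorb2)
  then have "z \<sqinter> (e \<squnion> f) = z \<sqinter> f" by (rule inf_cut[rotated]) simp
  then have "(e \<squnion> f) \<sqinter> z = a" using step(2) by (simp add: inf_commute)
  from packed.step[OF step.IH[OF step.prems(1) ef] this step(3)] show ?case
    by (simp add: sup.assoc)
qed

lemma packed_imp_independent:
  assumes "packed I a e k"
  shows "\<exists>z. independent_over a z k \<and> join_over a z {..<k} = e \<and> (\<forall>i<k. projective (a, z i) I)"
  using assms
proof (induction rule: packed.induct)
  case (empty a)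
  then show ?case by (auto simp: independent_over_def join_over_empty)
next
  case (step a e k z)
  then obtain w where w: "independent_over a w k" "join_over a w {..<k} = e"
    "\<forall>i<k. projective (a, w i) I" by auto
  let ?w = "w(k := z)"
  have eq: "join_over a ?w {..<i} = join_over a w {..<i}" if "i \<le> k" for i
    unfolding join_over_def using that
    by (intro arg_cong[of _ _ Sup_fin] arg_cong2[of _ _ _ _ insert] image_cong) auto
  have "independent_over a ?w (Suc k)"
    using w(1,2) step(2) eq unfolding independent_over_def by (auto simp: less_Suc_eq)
  moreover have "join_over a ?w {..<Suc k} = e \<squnion> z"
    using join_over_insert[of "{..<k}" a ?w k] eq[of k] w(2) by (simp add: lessThan_Suc sup_commute)
  moreover have "\<forall>i<Suc k. projective (a, ?w i) I" using w(3) step(3) by (auto simp: less_Suc_eq)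
  ultimately show ?case by blast
qed

lemma packed_bounded_if_n_distributive:
  fixes a :: "'a::modular_lattice"
  assumes rc: "relatively_complemented_on (UNIV :: 'a set)"
    and dist: "n_distributive_on n {a..b}" and "n \<ge> 1"
    and pack: "packed I a e k" and "e \<le> b" and I: "fst I \<noteq> snd I"
  shows "k \<le> n"
proof (rule ccontr)
  assume "\<not> k \<le> n"
  then have k: "Suc n \<le> k" by simp
  obtain z where z: "independent_over a z k" "join_over a z {..<k} = e"
    "\<And>i. i < k \<Longrightarrow> projective (a, z i) I"
    using packed_imp_independent[OF pack] by blast
  obtain w where w: "\<And>i. i < Suc n \<Longrightarrow> a \<le> w i \<and> w i \<le> z i" "w 0 \<noteq> a"
    "\<And>i. 1 \<le> i \<Longrightarrow> i < Suc n \<Longrightarrow> perspective a (w 0) (w i)"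
    using homogeneous_refinement[OF rc z(1) z(3) I _ k] by auto
  have "independent_over a z (Suc n)" using z(1) k unfolding independent_over_def by auto
  then have ind: "independent_over a w (Suc n)" by (rule independent_over_shrink) (use w(1) in auto)
  have wb: "w i \<le> b" if "i \<le> n" for i
  proof -
    have "z i \<le> e" unfolding z(2)[symmetric] using that k by (intro join_over_upper) auto
    then show ?thesis using w(1)[of i] that \<open>e \<le> b\<close> by (meson le_imp_less_Suc order.trans)
  qed
  show False
    using homogeneous_family_not_n_distributive[OF ind \<open>n \<ge> 1\<close> w(2) wb] w(3) dist by auto
qed


section \<open>Dissections and equality in the dimension monoid\<close>

text \<open>
  The defining relations of the dimension monoid are read as reduction rules, from an interval to its
  pieces, with the reversible relation (D2) in both directions.  Intervals are represented by pairs,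
  on which inversion is immediate.
\<close>

inductive dissects :: "'a::lattice \<Rightarrow> 'a \<Rightarrow> ('a \<times> 'a) multiset \<Rightarrow> bool" where
  degenerate: "dissects a a {#}"
| whole: "dissects a b {#(a, b)#}"
| split: "a \<le> b \<Longrightarrow> b \<le> c \<Longrightarrow> dissects a b Y \<Longrightarrow> dissects b c Z \<Longrightarrow> dissects a c (Y + Z)"
| up: "dissects (a \<sqinter> b) b Y \<Longrightarrow> dissects a (a \<squnion> b) Y"
| down: "dissects a (a \<squnion> b) Y \<Longrightarrow> dissects (a \<sqinter> b) b Y"

inductive dissects_all :: "('a::lattice \<times> 'a) multiset \<Rightarrow> ('a \<times> 'a) multiset \<Rightarrow> bool" where
  empty: "dissects_all {#} {#}"
| add: "dissects a b Y \<Longrightarrow> dissects_all X Z \<Longrightarrow> dissects_all (add_mset (a, b) X) (Y + Z)"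

lemma dissects_all_refl: "dissects_all X X"
proof (induction X)
  case (add I X)
  then show ?case using dissects_all.add[OF dissects.whole, of X X "fst I" "snd I"] by simp
qed (rule dissects_all.empty)

lemma dissects_all_single: "dissects a b Y \<Longrightarrow> dissects_all {#(a, b)#} Y"
  using dissects_all.add[OF _ dissects_all.empty, of a b Y] by simp

lemma dissects_all_union:
  "dissects_all X Y \<Longrightarrow> dissects_all X' Y' \<Longrightarrow> dissects_all (X + X') (Y + Y')"
  by (induction rule: dissects_all.induct) (auto simp: add.assoc intro: dissects_all.add)

lemma dissects_all_empty_left: "dissects_all {#} Y \<Longrightarrow> Y = {#}"
  by (auto elim: dissects_all.cases)

lemma dissects_all_add_msetE:
  assumes "dissects_all (add_mset (a, b) X) Z"
  obtains Z1 Z2 where "Z = Z1 + Z2" "dissects a b Z1" "dissects_all X Z2"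
proof -
  have "\<exists>Z1 Z2. Z = Z1 + Z2 \<and> dissects a b Z1 \<and> dissects_all X Z2"
    using assms
  proof (induction "add_mset (a, b) X" Z arbitrary: X rule: dissects_all.induct)
    case empty
    then show ?case by simp
  next
    case (add c d Y X' Z)
    show ?case
    proof (cases "(c, d) = (a, b)")
      case True
      then show ?thesis using add by auto
    next
      case False
      then obtain W where W: "X' = add_mset (a, b) W" "X = add_mset (c, d) W"
        using add.hyps(4) by (auto simp: add_eq_conv_ex)
      obtain Z1 Z2 where Z: "Z = Z1 + Z2" "dissects a b Z1" "dissects_all W Z2"
        using add.hyps(3)[OF W(1)] by blast
      have "dissects_all X (Y + Z2)" unfolding W using dissects_all.add[OF add.hyps(1) Z(3)] .
      then show ?thesis using Z by (intro exI[of _ Z1] exI[of _ "Y + Z2"]) (simp add: ac_simps)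
    qed
  qed
  then show thesis using that by blast
qed

lemma dissects_all_singleD: "dissects_all {#(a, b)#} Y \<Longrightarrow> dissects a b Y"
  by (erule dissects_all_add_msetE) (auto dest: dissects_all_empty_left)

lemma dissects_all_unionE:
  assumes "dissects_all (X + X') Z"
  obtains Z1 Z2 where "Z = Z1 + Z2" "dissects_all X Z1" "dissects_all X' Z2"
proof -
  have "\<exists>Z1 Z2. Z = Z1 + Z2 \<and> dissects_all X Z1 \<and> dissects_all X' Z2"
    using assms
  proof (induction X arbitrary: Z)
    case empty
    then show ?case using dissects_all.empty by (intro exI[of _ "{#}"] exI[of _ Z]) simp
  next
    case (add I X)
    obtain a b where I: "I = (a, b)" by fastforce
    from add.prems obtain W1 W2 where W: "Z = W1 + W2" "dissects a b W1" "dissects_all (X + X') W2"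
      unfolding I by (auto elim: dissects_all_add_msetE)
    obtain Z1 Z2 where Z: "W2 = Z1 + Z2" "dissects_all X Z1" "dissects_all X' Z2"
      using add.IH[OF W(3)] by blast
    have "dissects_all (add_mset I X) (W1 + Z1)" unfolding I by (rule dissects_all.add[OF W(2) Z(2)])
    then show ?case using W Z by (intro exI[of _ "W1 + Z1"] exI[of _ Z2]) (simp add: ac_simps)
  qed
  then show thesis using that by blast
qed

lemma dissects_trans: "dissects a b Y \<Longrightarrow> dissects_all Y Z \<Longrightarrow> dissects a b Z"
proof (induction arbitrary: Z rule: dissects.induct)
  case (degenerate a)
  then show ?case using dissects_all_empty_left dissects.degenerate by blast
next
  case (whole a b)
  then show ?case by (rule dissects_all_singleD)
next
  case (split a b c Y Z W)
  then show ?case by (metis dissects.split dissects_all_unionE)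
qed (auto intro: dissects.up dissects.down)

lemma dissects_all_trans: "dissects_all X Y \<Longrightarrow> dissects_all Y Z \<Longrightarrow> dissects_all X Z"
proof (induction arbitrary: Z rule: dissects_all.induct)
  case (add a b Y X W)
  then obtain Z1 Z2 where "Z = Z1 + Z2" "dissects_all Y Z1" "dissects_all W Z2"
    using dissects_all_unionE by metis
  then show ?case using add dissects_all.add dissects_trans by metis
qed simp

lemma dissects_nondegenerate:
  assumes "dissects a b Y" "a \<noteq> b"
  obtains c d where "(c, d) \<in># Y" "c \<noteq> d"
proof -
  have "\<exists>(c, d)\<in>#Y. c \<noteq> d" using assms
  proof (induction rule: dissects.induct)
    case (up a b Y)
    then show ?case by (metis inf.absorb_iff2 sup.absorb_iff1)
  next
    case (down a b Y)
    then show ?case by (metis inf.absorb_iff2 sup.absorb_iff1)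
  qed auto
  then show thesis using that by blast
qed

lemma dissects_all_degenerate: 
  assumes "dissects a a Y" shows "dissects_all Y {#}"
proof -
  have "dissects_all Y {#}" if "dissects a b Y" "a = b" for a b Y
    using that
  proof (induction rule: dissects.induct)
    case (split a b c Y Z)
    then have "a = b" "b = c" by (auto intro: order.antisym)
    then show ?case using split dissects_all_union[of Y "{#}" Z "{#}"] by simp
  next
    case (up a b Y)
    then have "b \<le> a" by (metis sup_ge2)
    then show ?case using up by (simp add: inf.absorb2)
  next
    case (down a b Y)
    then have "b \<le> a" by (metis inf_le1)
    then show ?case using down by (simp add: sup.absorb1)
  qed (auto intro: dissects_all.empty dissects_all_single dissects.degenerate)
  then show ?thesis using assms by blast
qed

definition have_common_dissection :: "('a::lattice \<times> 'a) multiset \<Rightarrow> ('a \<times> 'a) multiset \<Rightarrow> bool" where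
  "have_common_dissection X Y \<longleftrightarrow> (\<exists>W. dissects_all X W \<and> dissects_all Y W)"

text \<open>
  The one case of the Schreier refinement theorem from which confluence follows: a further cut
  at \<open>b\<close> is compatible with any dissection.  Where \<open>[a, c]\<close> was cut at \<open>d\<close>, the two parts are cut
  at \<open>b \<sqinter> d\<close> and \<open>d \<squnion> b\<close>; the pieces \<open>[b \<sqinter> d, d]\<close> and \<open>[d, d \<squnion> b]\<close> are transposes of
  \<open>[b, d \<squnion> b]\<close> and \<open>[b \<sqinter> d, b]\<close>.
\<close>

lemma dissects_insert_point:
  fixes a c :: "'a::modular_lattice"
  assumes "dissects a c Y" "a \<le> b" "b \<le> c"
  shows "have_common_dissection Y {#(a, b), (b, c)#}"
  using assms
proof (induction arbitrary: b rule: dissects.induct)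
  case (degenerate a)
  then have "b = a" by simp
  then have "dissects_all {#(a, b), (b, a)#} {#}"
    using dissects_all.add[OF dissects.degenerate dissects_all_single[OF dissects.degenerate]] by simp
  then show ?case unfolding have_common_dissection_def using dissects_all.empty by blast
next
  case (whole a c)
  then have "dissects_all {#(a, c)#} {#(a, b), (b, c)#}"
    using dissects_all_single[OF dissects.split[OF _ _ dissects.whole dissects.whole]]
    by (simp add: add_mset_commute)
  then show ?case unfolding have_common_dissection_def using dissects_all_refl by blast
next
  case (split a d c Y Z)
  have le: "a \<le> b \<sqinter> d" "b \<sqinter> d \<le> d" "d \<le> d \<squnion> b" "d \<squnion> b \<le> c" using split by auto
  obtain W1 where W1: "dissects_all Y W1" "dissects_all {#(a, b \<sqinter> d), (b \<sqinter> d, d)#} W1"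
    using split.IH(1)[OF le(1,2)] unfolding have_common_dissection_def by blast
  obtain W2 where W2: "dissects_all Z W2" "dissects_all {#(d, d \<squnion> b), (d \<squnion> b, c)#} W2"
    using split.IH(2)[OF le(3,4)] unfolding have_common_dissection_def by blast
  have "dissects a b {#(a, b \<sqinter> d), (d, d \<squnion> b)#}"
    using dissects.split[of a "b \<sqinter> d" b, OF _ _ dissects.whole] le
      dissects.down[OF dissects.whole, of d b]
    by (simp add: inf_commute add_mset_commute)
  moreover have "dissects b c {#(b \<sqinter> d, d), (d \<squnion> b, c)#}"
    using dissects.split[of b "b \<squnion> d" c, OF _ _ dissects.up[OF dissects.whole] dissects.whole] le
    by (simp add: sup_commute add_mset_commute)
  ultimately have "dissects_all {#(a, b), (b, c)#}
      ({#(a, b \<sqinter> d), (d, d \<squnion> b)#} + {#(b \<sqinter> d, d), (d \<squnion> b, c)#})"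
    by (intro dissects_all.add dissects_all_single)
  also have "{#(a, b \<sqinter> d), (d, d \<squnion> b)#} + {#(b \<sqinter> d, d), (d \<squnion> b, c)#} =
      {#(a, b \<sqinter> d), (b \<sqinter> d, d)#} + {#(d, d \<squnion> b), (d \<squnion> b, c)#}"
    by (simp add: ac_simps)
  finally have "dissects_all {#(a, b), (b, c)#} (W1 + W2)"
    using dissects_all_union[OF W1(2) W2(2)] dissects_all_trans by blast
  then show ?case unfolding have_common_dissection_def
    using dissects_all_union[OF W1(1) W2(1)] by blast
next
  case (up a d Y)
  have "a \<sqinter> d \<le> b \<sqinter> d" "b \<sqinter> d \<le> d" using up.prems by (auto intro: le_infI1)
  from up.IH[OF this] obtain W where
    W: "dissects_all Y W" "dissects_all {#(a \<sqinter> d, b \<sqinter> d), (b \<sqinter> d, d)#} W"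
    unfolding have_common_dissection_def by blast
  have "a \<squnion> (b \<sqinter> d) = b" 
    using modular_law[OF up.prems(1), of d] up.prems(2) by (simp add: inf_commute inf.absorb1 inf.absorb2)
  moreover have "a \<sqinter> (b \<sqinter> d) = a \<sqinter> d" using up.prems(1) by (simp add: inf.absorb1 inf.assoc[symmetric])
  ultimately have 1: "dissects a b {#(a \<sqinter> d, b \<sqinter> d)#}"
    using dissects.up[OF dissects.whole, of a "b \<sqinter> d"] by simp
  have "b \<squnion> d = a \<squnion> d" using up.prems by (intro order.antisym) (auto intro: le_supI1)
  then have 2: "dissects b (a \<squnion> d) {#(b \<sqinter> d, d)#}"
    using dissects.up[OF dissects.whole, of b d] by simp
  have "dissects_all {#(a, b), (b, a \<squnion> d)#} {#(a \<sqinter> d, b \<sqinter> d), (b \<sqinter> d, d)#}"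
    using dissects_all.add[OF 1 dissects_all_single[OF 2]] by (simp add: add_mset_commute)
  then show ?case using W dissects_all_trans unfolding have_common_dissection_def by blast
next
  case (down a d Y)
  have "a \<le> a \<squnion> b" "a \<squnion> b \<le> a \<squnion> d" using down.prems by (auto intro: le_supI2)
  from down.IH[OF this] obtain W where
    W: "dissects_all Y W" "dissects_all {#(a, a \<squnion> b), (a \<squnion> b, a \<squnion> d)#} W"
    unfolding have_common_dissection_def by blast
  have "a \<sqinter> b = a \<sqinter> d" using down.prems by (intro order.antisym) (auto intro: le_infI2)
  then have 1: "dissects (a \<sqinter> d) b {#(a, a \<squnion> b)#}"
    using dissects.down[OF dissects.whole, of a b] by simp
  have "(a \<squnion> b) \<sqinter> d = b"
    using modular_law[OF down.prems(2), of a] down.prems(1) by (simp add: sup_commute sup.absorb1 sup.absorb2)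
  moreover have "(a \<squnion> b) \<squnion> d = a \<squnion> d" using down.prems by (simp add: sup.assoc sup.absorb2)
  ultimately have 2: "dissects b d {#(a \<squnion> b, a \<squnion> d)#}"
    using dissects.down[OF dissects.whole, of "a \<squnion> b" d] by simp
  have "dissects_all {#(a \<sqinter> d, b), (b, d)#} {#(a, a \<squnion> b), (a \<squnion> b, a \<squnion> d)#}"
    using dissects_all.add[OF 1 dissects_all_single[OF 2]] by (simp add: add_mset_commute)
  then show ?case using W dissects_all_trans unfolding have_common_dissection_def by blast
qed

text \<open>
  A cut at \<open>b\<close> in the first dissection is imposed on the second one by the preceding lemma, and then
  both halves are treated by induction; transpositions are absorbed by their inverses.
\<close>

lemma dissects_confluent:
  fixes a b :: "'a::modular_lattice"
  assumes "dissects a b Y" "dissects a b Z"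
  shows "have_common_dissection Y Z"
  using assms
proof (induction arbitrary: Z rule: dissects.induct)
  case (degenerate a)
  show ?case unfolding have_common_dissection_def
    using dissects_all_degenerate[OF degenerate] dissects_all.empty by blast
next
  case (whole a b)
  then show ?case unfolding have_common_dissection_def
    using dissects_all_single dissects_all_refl by blast
next
  case (split a b c Y1 Y2)
  have "have_common_dissection Z {#(a, b), (b, c)#}"
    using dissects_insert_point split by blast
  then obtain V where V: "dissects_all Z V" "dissects_all {#(a, b), (b, c)#} V"
    unfolding have_common_dissection_def by blast
  then obtain V1 V2 where V12: "V = V1 + V2" "dissects a b V1" "dissects b c V2"
    using dissects_all_add_msetE dissects_all_singleD by metis
  obtain W1 W2 where W: "dissects_all Y1 W1" "dissects_all V1 W1" "dissects_all Y2 W2" "dissects_all V2 W2"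
    using split.IH(1)[OF V12(2)] split.IH(2)[OF V12(3)] unfolding have_common_dissection_def by blast
  have "dissects_all Z (W1 + W2)"
    using dissects_all_trans V(1) V12(1) dissects_all_union[OF W(2,4)] by blast
  then show ?case unfolding have_common_dissection_def
    using dissects_all_union[OF W(1,3)] by blast
next
  case (up a b Y)
  then show ?case using dissects.down by blast
next
  case (down a b Y)
  then show ?case using dissects.up by blast
qed

lemma dissects_all_confluent:
  fixes X :: "('a::modular_lattice \<times> 'a) multiset"
  assumes "dissects_all X Y" "dissects_all X Z"
  shows "have_common_dissection Y Z"
  using assms
proof (induction arbitrary: Z rule: dissects_all.induct)
  case empty
  then show ?case unfolding have_common_dissection_def using dissects_all_refl by blast
next
  case (add a b Y1 X Y2)
  obtain Z1 Z2 where Z: "Z = Z1 + Z2" "dissects a b Z1" "dissects_all X Z2"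
    using dissects_all_add_msetE[OF add.prems] .
  obtain W1 W2 where "dissects_all Y1 W1" "dissects_all Z1 W1" "dissects_all Y2 W2" "dissects_all Z2 W2"
    using dissects_confluent[OF add.hyps(1) Z(2)] add.IH[OF Z(3)]
    unfolding have_common_dissection_def by blast
  then show ?case unfolding have_common_dissection_def Z(1) by (metis dissects_all_union)
qed

lemma have_common_dissection_trans:
  fixes X :: "('a::modular_lattice \<times> 'a) multiset"
  assumes "have_common_dissection X Y" "have_common_dissection Y Z"
  shows "have_common_dissection X Z"
proof -
  obtain V W where "dissects_all X V" "dissects_all Y V" "dissects_all Y W" "dissects_all Z W"
    using assms unfolding have_common_dissection_def by blast
  then show ?thesis
    using dissects_all_confluent dissects_all_trans unfolding have_common_dissection_def by metis
qed

definition bounds :: "'a::preorder interval \<Rightarrow> 'a \<times> 'a" where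
  "bounds I = (lower I, upper I)"

lemma bounds_Interval: "a \<le> b \<Longrightarrow> bounds (Interval (a, b)) = (a, b)"
  unfolding bounds_def by (simp add: lower_Interval upper_Interval)

text \<open>
  Confluence makes the relation transitive, so it is a congruence that contains the defining
  relations.
\<close>

lemma dim_cong_imp_common_dissection:
  fixes X :: "'a::modular_lattice interval multiset"
  assumes "dim_cong X Y"
  shows "have_common_dissection (image_mset bounds X) (image_mset bounds Y)"
  using assms
proof induction
  case (D0 a)
  show ?case unfolding have_common_dissection_def
    using dissects_all_single[OF dissects.degenerate, of a] dissects_all.empty
    by (simp add: bounds_Interval) blast
next
  case (D1 a b c)
  then have "dissects_all {#(a, c)#} {#(a, b), (b, c)#}"
    using dissects_all_single[OF dissects.split[OF D1 dissects.whole dissects.whole]]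
    by (simp add: add_mset_commute)
  moreover have "a \<le> c" using D1 by order
  ultimately show ?case unfolding have_common_dissection_def
    using D1 dissects_all_refl[of "{#(a, b), (b, c)#}"] by (simp add: bounds_Interval) blast
next
  case (D2 a b)
  have "dissects_all {#(a, a \<squnion> b)#} {#(a \<sqinter> b, b)#}"
    by (rule dissects_all_single[OF dissects.up[OF dissects.whole]])
  then show ?case unfolding have_common_dissection_def
    using dissects_all_refl[of "{#(a \<sqinter> b, b)#}"] by (simp add: bounds_Interval) blast
next
  case (refl X)
  then show ?case unfolding have_common_dissection_def using dissects_all_refl by blast
next
  case (sym X Y)
  then show ?case unfolding have_common_dissection_def by blast
next
  case (trans X Y Z)
  then show ?case using have_common_dissection_trans by blast
next
  case (add X Y X' Y')
  then show ?case unfolding have_common_dissection_def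
    by (metis dissects_all_union image_mset_union)
qed

lemma dissects_all_repeat: "dissects_all X Y \<Longrightarrow> dissects_all (repeat_mset n X) (repeat_mset n Y)"
  by (induction n) (auto intro: dissects_all_refl dissects_all_union)

text \<open>
  The copies may be dissected differently; confluence, applied to one copy after the other, makes
  their dissections agree.
\<close>

lemma dissects_all_replicate:
  fixes u v :: "'a::modular_lattice"
  assumes "dissects_all (replicate_mset n (u, v)) W"
  obtains V where "dissects u v V" "dissects_all W (repeat_mset n V)"
proof -
  have "\<exists>V. dissects u v V \<and> dissects_all W (repeat_mset n V)"
    using assms
  proof (induction n arbitrary: W)
    case 0
    then have "W = {#}" using dissects_all_empty_left by simp
    then show ?case using dissects.whole[of u v] dissects_all.empty by auto
  next
    case (Suc n)
    obtain W1 W2 where W: "W = W1 + W2" "dissects u v W1" "dissects_all (replicate_mset n (u, v)) W2"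
      using dissects_all_add_msetE Suc.prems by (metis replicate_mset_Suc)
    obtain V where V: "dissects u v V" "dissects_all W2 (repeat_mset n V)"
      using Suc.IH[OF W(3)] by blast
    obtain U where U: "dissects_all W1 U" "dissects_all V U"
      using dissects_confluent[OF W(2) V(1)] unfolding have_common_dissection_def by blast
    have "dissects_all W2 (repeat_mset n U)"
      using dissects_all_trans[OF V(2) dissects_all_repeat[OF U(2)]] .
    then have "dissects_all W (repeat_mset (Suc n) U)"
      unfolding W(1) using dissects_all_union[OF U(1)] by simp
    then show ?case using dissects_trans[OF W(2) U(1)] by blast
  qed
  then show thesis using that by blast
qed

text \<open>
  At a cut of \<open>[a, c]\<close> at \<open>b\<close>, the packing of \<open>[b, c]\<close> is moved to \<open>[a, b']\<close> for a relative complement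
  \<open>b'\<close> of \<open>b\<close>, where it is disjoint from the packing of \<open>[a, b]\<close>.
\<close>

lemma dissects_imp_packed:
  fixes a b :: "'a::modular_lattice"
  assumes rc: "relatively_complemented_on (UNIV :: 'a set)" and "dissects a b Y" "a \<le> b"
  shows "\<exists>e\<le>b. packed I a e (count Y I)"
  using assms(2,3)
proof (induction rule: dissects.induct)
  case (degenerate a)
  then show ?case using packed.empty[of I a] by auto
next
  case (whole a b)
  show ?case
  proof (cases "I = (a, b)")
    case True
    have "packed I a (a \<squnion> b) (Suc 0)"
      by (rule packed.step[OF packed.empty]) (use whole True projective_refl in \<open>auto simp: inf.absorb1\<close>)
    then show ?thesis using whole True by (auto simp: sup.absorb2)
  next
    case False
    then show ?thesis using packed.empty[of I a] whole by auto
  qed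
next
  case (split a b c Y Z)
  obtain e f where e: "e \<le> b" "packed I a e (count Y I)" and f: "f \<le> c" "packed I b f (count Z I)"
    using split by blast
  obtain b' where b': "b \<sqinter> b' = a" "b \<squnion> b' = c"
    using relative_complement[OF rc split.hyps(1,2)] .
  have f': "packed I a (f \<sqinter> b') (count Z I)"
    using packed_transpose_down[OF f(2), of b'] f(1) b' by simp
  have "b \<sqinter> (f \<sqinter> b') = a"
    using packed_ge[OF f'] by (intro inf_eq_mono[OF b'(1)]) (use split.hyps in auto)
  then have "e \<sqinter> (f \<sqinter> b') = a"
    by (rule inf_eq_mono) (use packed_ge[OF f'] packed_ge[OF e(2)] e(1) in auto)
  from packed_join[OF f' e(2) this] have "packed I a (e \<squnion> (f \<sqinter> b')) (count (Y + Z) I)" by simp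
  moreover have "e \<squnion> (f \<sqinter> b') \<le> c" using e(1) f(1) split.hyps(2) by (auto intro: le_infI1)
  ultimately show ?case by blast
next
  case (up a b Y)
  then obtain e where "e \<le> b" "packed I (a \<sqinter> b) e (count Y I)" by auto
  then show ?case using packed_transpose_up[of I a b] by (intro exI[of _ "a \<squnion> e"]) (auto intro: le_supI2)
next
  case (down a b Y)
  then obtain e where "e \<le> a \<squnion> b" "packed I a e (count Y I)" by auto
  then show ?case using packed_transpose_down[of I a _ _ b] by (intro exI[of _ "e \<sqinter> b"]) auto
qed

lemma dissections_have_bounded_multiplicity:
  fixes X :: "('a::modular_lattice \<times> 'a) multiset"
  assumes rc: "relatively_complemented_on (UNIV :: 'a set)"
    and lfd: "locally_finitely_distributive_on (UNIV :: 'a set)"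
    and X: "\<And>a b. (a, b) \<in># X \<Longrightarrow> a \<le> b"
  shows "\<exists>N. \<forall>Y I. dissects_all X Y \<longrightarrow> fst I \<noteq> snd I \<longrightarrow> count Y I \<le> N"
  using X
proof (induction X)
  case empty
  then show ?case using dissects_all_empty_left by fastforce
next
  case (add J X)
  obtain a b where J: "J = (a, b)" by fastforce
  have "a \<le> b" using add.prems J by simp
  obtain N where N: "\<And>Y I. dissects_all X Y \<Longrightarrow> fst I \<noteq> snd I \<Longrightarrow> count Y I \<le> N"
    using add by (metis union_single_eq_member add_mset_add_single union_iff)
  obtain n where n: "n \<ge> 1" "n_distributive_on n {a..b}"
    using lfd \<open>a \<le> b\<close> unfolding locally_finitely_distributive_on_def finitely_distributive_on_def by auto
  have "count Y I \<le> n + N" if Y: "dissects_all (add_mset J X) Y" and I: "fst I \<noteq> snd I" for Y I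
  proof -
    obtain Y1 Y2 where Y12: "Y = Y1 + Y2" "dissects a b Y1" "dissects_all X Y2"
      using dissects_all_add_msetE Y unfolding J by metis
    obtain e where "e \<le> b" "packed I a e (count Y1 I)"
      using dissects_imp_packed[OF rc Y12(2) \<open>a \<le> b\<close>] by blast
    then have "count Y1 I \<le> n"
      using packed_bounded_if_n_distributive[OF rc n(2,1) _ _ I] by blast
    then show ?thesis using N[OF Y12(3) I] Y12(1) by simp
  qed
  then show ?case by blast
qed


section \<open>The index in the dimension monoid\<close>

lemma index_finite_iff:
  fixes x :: "'m::comm_monoid_add"
  shows "index x \<noteq> \<infinity> \<longleftrightarrow> (\<exists>N. \<forall>n. index_bound x n \<longrightarrow> n \<le> N)"
proof (cases "\<forall>y::'m. y = 0")
  case True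
  then show ?thesis unfolding index_def index_bound_def by auto
next
  case False
  have "index_bound x 0" using False unfolding index_bound_def alg_le_def by auto
  have *: "\<exists>n. index_bound x n \<and> (\<forall>m. index_bound x m \<longrightarrow> m \<le> n)"
    if bd: "\<And>n. index_bound x n \<Longrightarrow> n \<le> N" for N
  proof (intro exI conjI allI impI)
    show "index_bound x (GREATEST n. index_bound x n)"
      by (rule GreatestI_nat[where P = "index_bound x", OF \<open>index_bound x 0\<close> bd])
    show "m \<le> (GREATEST n. index_bound x n)" if m: "index_bound x m" for m
      by (rule Greatest_le_nat[where P = "index_bound x", OF m bd])
  qed
  then have "(\<exists>N. \<forall>n. index_bound x n \<longrightarrow> n \<le> N) \<longleftrightarrow>
      (\<exists>n. index_bound x n \<and> (\<forall>m. index_bound x m \<longrightarrow> m \<le> n))" by blast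
  then show ?thesis unfolding index_def if_not_P[OF False] by simp
qed

lemma Delta_eq_0_iff: 
  assumes "a \<le> b" shows "Delta a b = 0 \<longleftrightarrow> a = b"
proof
  assume "Delta a b = 0"
  then have "dim_cong {#Interval (a, b)#} {#}"
    by (simp add: Delta_def zero_dim_def dim.abs_eq_iff)
  from dim_cong_degenerate[OF this] show "a = b"
    using assms by (simp add: lower_Interval upper_Interval)
qed (simp add: Delta_D0)

lemma alg_le_add:
  assumes "alg_le x y" "alg_le x' y'"
  shows "alg_le (x + x') (y + y')"
proof -
  obtain z z' where "y = x + z" "y' = x' + z'" using assms unfolding alg_le_def by blast
  then have "x + x' + (z + z') = y + y'" by (simp add: ac_simps)
  then show ?thesis unfolding alg_le_def by blast
qed

lemma alg_le_trans:
  assumes "alg_le x y" "alg_le y z"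
  shows "alg_le x z"
proof -
  obtain u v where "y = x + u" "z = y + v" using assms unfolding alg_le_def by blast
  then have "x + (u + v) = z" by (simp add: ac_simps)
  then show ?thesis unfolding alg_le_def by blast
qed

lemma alg_le_Delta_subinterval:
  assumes "a \<le> c" "c \<le> d" "d \<le> b"
  shows "alg_le (Delta c d) (Delta a b)"
proof -
  have "c \<le> b" using assms by order
  then have "Delta c d + (Delta a c + Delta d b) = Delta a b"
    using Delta_D1[OF assms(1), of b] Delta_D1[OF assms(2,3)] by (simp add: ac_simps)
  then show ?thesis unfolding alg_le_def by blast
qed

text \<open>
  Let \<open>u < w\<close> be the two sides of the violated law.  As \<open>w \<le> x \<squnion> z\<^sub>i\<close>, the interval \<open>[u, w]\<close> is the
  transpose of \<open>[u \<sqinter> z\<^sub>i \<sqinter> w, z\<^sub>i \<sqinter> w]\<close>, which lies in \<open>[p, z\<^sub>i]\<close>.  The \<open>z\<^sub>i\<close> are independent over \<open>p\<close>,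
  because all but \<open>z\<^sub>i\<close> lie below \<open>y\<^sub>i\<close>; hence the dimensions of the \<open>[p, z\<^sub>i]\<close> add up.
\<close>

lemma index_bound_if_not_n_distributive:
  fixes a b :: "'a::modular_lattice"
  assumes "n \<ge> 1" "\<not> n_distributive_on n {a..b}"
  shows "index_bound (Delta a b) (Suc n)"
proof -
  obtain x y where x: "x \<in> {a..b}" and y: "\<And>i. i \<le> n \<Longrightarrow> y i \<in> {a..b}"
    and ne: "x \<squnion> (\<Sqinter>\<^sub>f\<^sub>i\<^sub>n (y ` {i. i \<le> n})) \<noteq>
        \<Sqinter>\<^sub>f\<^sub>i\<^sub>n ((\<lambda>i. x \<squnion> \<Sqinter>\<^sub>f\<^sub>i\<^sub>n (y ` {j. j \<le> n \<and> j \<noteq> i})) ` {i. i \<le> n})"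
    using assms(2) unfolding n_distributive_on_def by blast
  define p where "p = \<Sqinter>\<^sub>f\<^sub>i\<^sub>n (y ` {i. i \<le> n})"
  define z where "z i = \<Sqinter>\<^sub>f\<^sub>i\<^sub>n (y ` {j. j \<le> n \<and> j \<noteq> i})" for i
  define u where "u = x \<squnion> p"
  define w where "w = \<Sqinter>\<^sub>f\<^sub>i\<^sub>n ((\<lambda>i. x \<squnion> z i) ` {i. i \<le> n})"
  have ne_idx: "{j. j \<le> n \<and> j \<noteq> i} \<noteq> {}" for i
  proof -
    have "(if i = 0 then 1 else 0) \<in> {j. j \<le> n \<and> j \<noteq> i}" using \<open>n \<ge> 1\<close> by auto
    then show ?thesis by blast
  qed
  have py: "p \<le> y i" if "i \<le> n" for i
    unfolding p_def using that by (intro Inf_fin.coboundedI) auto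
  have zy: "z i \<le> y j" if "j \<le> n" "j \<noteq> i" for i j
    unfolding z_def using that by (intro Inf_fin.coboundedI) auto
  have pz: "p \<le> z i" for i
    unfolding z_def using ne_idx py by (intro Inf_fin.boundedI) auto
  have zyp: "z i \<sqinter> y i = p" if "i \<le> n" for i
  proof (rule order.antisym)
    have "z i \<sqinter> y i \<le> y j" if "j \<le> n" for j using zy[OF that, of i] by (cases "j = i") (auto intro: le_infI1)
    then show "z i \<sqinter> y i \<le> p" unfolding p_def by (intro Inf_fin.boundedI) auto
  qed (use pz py that in simp)
  have "a \<le> p" unfolding p_def using y by (intro Inf_fin.boundedI) auto
  have zb: "z i \<le> b" for i
  proof -
    obtain j where "j \<le> n" "j \<noteq> i" using ne_idx by blast
    then show ?thesis using zy[of j i] y[of j] by auto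
  qed
  have wz: "w \<le> x \<squnion> z i" if "i \<le> n" for i
    unfolding w_def using that by (intro Inf_fin.coboundedI) auto
  have "u \<le> w"
    unfolding u_def w_def using pz by (intro Inf_fin.boundedI) (auto intro: le_supI2)
  moreover have "u \<noteq> w" using ne unfolding u_def w_def p_def z_def .
  ultimately have nz: "Delta u w \<noteq> 0" using Delta_eq_0_iff by metis
  have piece: "alg_le (Delta u w) (Delta p (z i))" if "i \<le> n" for i
  proof -
    have "u \<squnion> (z i \<sqinter> w) = (u \<squnion> z i) \<sqinter> w" by (rule modular_law[OF \<open>u \<le> w\<close>])
    also have "\<dots> = w"
      using wz[OF that] pz[of i] unfolding u_def by (simp add: sup.assoc sup.absorb2 inf.absorb2)
    finally have "Delta u w = Delta (u \<sqinter> (z i \<sqinter> w)) (z i \<sqinter> w)" using Delta_D2 by metis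
    moreover have *: "p \<le> u \<sqinter> (z i \<sqinter> w)"
      using pz[of i] \<open>u \<le> w\<close> unfolding u_def by (auto intro: order.trans[OF sup_ge2])
    ultimately show ?thesis using alg_le_Delta_subinterval[OF * inf_le2 inf_le1] by simp
  qed
  have "alg_le (\<Sum>_<m. Delta u w) (Delta p (join_over p z {..<m}))" if "m \<le> Suc n" for m
    using that
  proof (induction m)
    case 0
    then show ?case by (simp add: join_over_empty Delta_D0 alg_le_def)
  next
    case (Suc m)
    let ?J = "join_over p z {..<m}"
    have "?J \<le> y m" using Suc.prems py zy by (intro join_over_least) auto
    moreover have "p \<le> ?J" by (rule join_over_base) simp
    ultimately have "?J \<sqinter> z m = p"
      using zyp[of m] pz[of m] Suc.prems inf_eq_mono[of "y m" "z m" p ?J "z m"] by (simp add: inf_commute)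
    then have "Delta p (?J \<squnion> z m) = Delta p ?J + Delta p (z m)"
      using Delta_D1[OF \<open>p \<le> ?J\<close>, of "?J \<squnion> z m"] Delta_D2[of ?J "z m"] by simp
    moreover have "join_over p z {..<Suc m} = ?J \<squnion> z m"
      using join_over_insert[of "{..<m}" p z m] by (simp add: lessThan_Suc sup_commute)
    ultimately show ?case using alg_le_add[OF Suc.IH piece[of m]] Suc.prems by (simp add: add.commute)
  qed
  from this[of "Suc n"] have "alg_le (\<Sum>_<Suc n. Delta u w) (Delta p (join_over p z {..<Suc n}))" by simp
  moreover have "join_over p z {..<Suc n} \<le> b"
    using zb pz[of 0] by (intro join_over_least) (auto intro: order.trans)
  then have "alg_le (Delta p (join_over p z {..<Suc n})) (Delta a b)"
    using alg_le_Delta_subinterval[OF \<open>a \<le> p\<close> join_over_base] by simp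
  ultimately have "alg_le (\<Sum>_<Suc n. Delta u w) (Delta a b)" by (rule alg_le_trans)
  with nz show ?thesis unfolding index_bound_def by blast
qed

lemma abs_dim_surj: obtains X where "x = abs_dim X"
proof -
  have "\<exists>X. x = abs_dim X" by (rule dim.abs_induct) (rule exI, rule HOL.refl)
  then show thesis using that by blast
qed

lemma sum_constant_abs_dim: "(\<Sum>_<n. abs_dim Y) = abs_dim (repeat_mset n Y)"
proof (induction n)
  case 0
  show ?case by (simp add: zero_dim_def)
next
  case (Suc n)
  then show ?case by (simp add: plus_dim.abs_eq add.commute)
qed

lemma index_finite_if_relatively_complemented:
  fixes x :: "'a::modular_lattice dim"
  assumes rc: "relatively_complemented_on (UNIV :: 'a set)"
    and lfd: "locally_finitely_distributive_on (UNIV :: 'a set)"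
  shows "index x \<noteq> \<infinity>"
proof -
  obtain X where X: "x = abs_dim X" by (rule abs_dim_surj)
  have X_le: "a \<le> b" if "(a, b) \<in># image_mset bounds X" for a b
    using that by (auto simp: bounds_def)
  obtain N where N: "\<And>Y I. dissects_all (image_mset bounds X) Y \<Longrightarrow> fst I \<noteq> snd I \<Longrightarrow> count Y I \<le> N"
    using dissections_have_bounded_multiplicity[OF rc lfd, of "image_mset bounds X"] X_le by blast
  have "n \<le> N" if bound: "index_bound x n" for n
  proof -
    obtain y z where y: "y \<noteq> 0" "(\<Sum>_<n. y) + z = x"
      using bound unfolding index_bound_def alg_le_def by blast
    obtain Y where Y: "y = abs_dim Y" by (rule abs_dim_surj)
    obtain Z where Z: "z = abs_dim Z" by (rule abs_dim_surj)
    have "\<not> dim_cong Y {#}" using y(1) Y by (simp add: zero_dim_def dim.abs_eq_iff)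
    \<comment> \<open>a summand of the nonzero element is nondegenerate, and it suffices to count its copies\<close>
    then obtain I where I: "I \<in># Y" "lower I \<noteq> upper I" using dim_cong_empty by blast
    then obtain Y' where Y': "Y = add_mset I Y'" by (metis multi_member_split)
    have "dim_cong X (repeat_mset n Y + Z)"
      using y(2) unfolding X Y Z sum_constant_abs_dim plus_dim.abs_eq dim.abs_eq_iff
      by (rule dim_cong.sym)
    then obtain W where W: "dissects_all (image_mset bounds X) W"
      "dissects_all (image_mset bounds (repeat_mset n Y + Z)) W"
      using dim_cong_imp_common_dissection unfolding have_common_dissection_def by blast
    have "image_mset bounds (repeat_mset n Y + Z) = replicate_mset n (bounds I) +
        image_mset bounds (repeat_mset n Y' + Z)"
      unfolding Y' by (induction n) (simp_all add: ac_simps)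
    then have "dissects_all (replicate_mset n (lower I, upper I) +
        image_mset bounds (repeat_mset n Y' + Z)) W"
      using W(2) by (metis bounds_def)
    then obtain W1 W2 where W12: "W = W1 + W2" "dissects_all (replicate_mset n (lower I, upper I)) W1"
      by (rule dissects_all_unionE)
    obtain V where V: "dissects (lower I) (upper I) V" "dissects_all W1 (repeat_mset n V)"
      using dissects_all_replicate[OF W12(2)] .
    obtain c d where cd: "(c, d) \<in># V" "c \<noteq> d" using dissects_nondegenerate[OF V(1) I(2)] .
    have "dissects_all (image_mset bounds X) (repeat_mset n V + W2)"
      using dissects_all_trans[OF W(1)] dissects_all_union[OF V(2) dissects_all_refl] W12(1) by blast
    then have "count (repeat_mset n V + W2) (c, d) \<le> N" by (rule N) (simp add: cd(2))
    moreover have "0 < count V (c, d)" using cd(1) by simp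
    then have "n \<le> n * count V (c, d)" by simp
    moreover have "count (repeat_mset n V + W2) (c, d) = n * count V (c, d) + count W2 (c, d)" by simp
    ultimately show ?thesis by linarith
  qed
  then show ?thesis unfolding index_finite_iff by blast
qed

lemma locally_finitely_distributive_if_index_finite:
  assumes fin: "\<forall>x :: 'a::modular_lattice dim. index x \<noteq> \<infinity>"
  shows "locally_finitely_distributive_on (UNIV :: 'a set)"
  unfolding locally_finitely_distributive_on_def finitely_distributive_on_def
proof (intro ballI impI)
  fix a b :: 'a
  obtain N where N: "\<And>n. index_bound (Delta a b) n \<Longrightarrow> n \<le> N"
    using fin index_finite_iff by metis
  have "n_distributive_on (Suc N) {a..b}"
    using index_bound_if_not_n_distributive[of "Suc N" a b] N[of "Suc (Suc N)"] by auto
  then show "\<exists>n\<ge>1. n_distributive_on n (UNIV \<inter> {a..b})" by (intro exI[of _ "Suc N"]) simp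
qed


section \<open>Finite index and local finite distributivity\<close>

theorem theorem11p17:
  shows "((\<forall>x :: 'a::modular_lattice dim. index x \<noteq> \<infinity>) \<longrightarrow>
            locally_finitely_distributive_on (UNIV :: 'a set)) \<and>
         (relatively_complemented_on (UNIV :: 'a set) \<and>
          locally_finitely_distributive_on (UNIV :: 'a set) \<longrightarrow>
            (\<forall>x :: 'a dim. index x \<noteq> \<infinity>))"
  using locally_finitely_distributive_if_index_finite index_finite_if_relatively_complemented by blast

end
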